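(* Let $a>0$. Write $E=e^{-ax^{2}-bx}$, $\kappa_j=\sqrt{\frac2\pi}\,e^{-ax^{2}}K_{j+\frac12}(bx)$, $\Upsilon(\upsilon)=\Upsilon(\upsilon,a,b,x)$, and let $V(0,0)$, $V(1,1)$ be the functions of $x$ defined in the context. Then the following indefinite integrals hold: $$\int\frac{e^{-ax^{2}}\Gamma(1,bx)}{x}\,dx=\int\frac{E}{x}\,dx=\Upsilon(1);$$ $$\int\frac{e^{-ax^{2}}\Gamma(2,bx)}{x}\,dx=\int b\left(\frac{\kappa_0}{\sqrt{bx}}+\sqrt{bx}\,\kappa_0\right)dx=\int\left(\frac Ex+bE\right)dx=\Upsilon(1)+bV(0,0);$$ $$\int\frac{e^{-ax^{2}}\Gamma(3,bx)}{x}\,dx=\int b\left(\frac{2\kappa_0}{\sqrt{bx}}+(bx)^{3/2}\kappa_1+2\left(1-\tfrac12\right)\sqrt{bx}\,\kappa_0\right)dx=\int b\left(\frac{2E}{bx}+E+bx\left(\frac1{bx}+1\right)E\right)dx=2\Upsilon(1)+bV(0,0)+bV(1,1);$$ $$\int\frac{e^{-ax^{2}}\Gamma(3,bx)}{b^{2}x^{3}}\,dx=\int\left(\frac{b\kappa_0}{\sqrt{bx}}+\frac{2b\kappa_1}{(bx)^{3/2}}\right)dx=\int\left(\frac Ex+\frac{2\left(1+\frac1{bx}\right)E}{bx^{2}}\right)dx=\Upsilon(1)+\frac2b\Upsilon(2)+\frac2{b^{2}}\Upsilon(3);$$ $$\int\frac{e^{-ax^{2}}\Gamma(4,bx)}{b^{2}x^{3}}\,dx=\int\left(\frac{3b\kappa_0}{\sqrt{bx}}+\frac{6b\kappa_1}{(bx)^{3/2}}+b\sqrt{bx}\,\kappa_0\right)dx=\int\left(\frac{3E}x+\frac{6\left(1+\frac1{bx}\right)E}{bx^{2}}+bE\right)dx$$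 $$=3\Upsilon(1)+\frac6b\Upsilon(2)+\frac6{b^{2}}\Upsilon(3)+bV(0,0);$$ $$\int\frac{e^{-ax^{2}}\Gamma(5,bx)}{b^{2}x^{3}}\,dx=\int\left(\frac{12b\kappa_0}{\sqrt{bx}}+\frac{24b\kappa_1}{(bx)^{3/2}}+3b\sqrt{bx}\,\kappa_0+b(bx)^{3/2}\kappa_1\right)dx$$ $$=\int\left(\frac{12E}x+\frac{24\left(\frac1{bx}+1\right)E}{bx^{2}}+3bE+b^{2}x\left(\frac1{bx}+1\right)E\right)dx=12\Upsilon(1)+\frac{24}b\Upsilon(2)+\frac{24}{b^{2}}\Upsilon(3)+3bV(0,0)+bV(1,1);$$ $$\int\frac{e^{-ax^{2}}\Gamma(5,bx)}{b^{4}x^{5}}\,dx=\int\left(\frac{b\kappa_0}{\sqrt{bx}}+\frac{4b\kappa_1}{(bx)^{3/2}}+\frac{8b\kappa_2}{(bx)^{5/2}}\right)dx=\int\left(\frac Ex+\frac{4\left(1+\frac1{bx}\right)E}{bx^{2}}+\frac{8\left(1+\frac3{bx}+\frac3{b^{2}x^{2}}\right)E}{b^{2}x^{3}}\right)dx$$ $$=\Upsilon(1)+\frac4b\Upsilon(2)+\frac{4+8}{b^{2}}\Upsilon(3)+\frac{24}{b^{3}}\Upsilon(4)+\frac{24}{b^{4}}\Upsilon(5);$$ $$\int\frac{e^{-ax^{2}}\Gamma(6,bx)}{b^{4}x^{5}}\,dx=\int\left(\frac{5b\kappa_0}{\sqrt{bx}}+\frac{20b\kappa_1}{(bx)^{3/2}}+\frac{40b\kappa_2}{(bx)^{5/2}}+b\sqrt{bx}\,\kappa_0\right)dx$$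 $$=\int\left(\frac{5E}x+\frac{20\left(\frac1{bx}+1\right)E}{bx^{2}}+\frac{40\left(\frac3{b^{2}x^{2}}+\frac3{bx}+1\right)E}{b^{2}x^{3}}+bE\right)dx$$ $$=5\Upsilon(1)+\frac{20}b\Upsilon(2)+\frac{60}{b^{2}}\Upsilon(3)+\frac{120}{b^{3}}\Upsilon(4)+\frac{120}{b^{4}}\Upsilon(5)+bV(0,0);$$ $$\int\frac{e^{-ax^{2}}\Gamma(7,bx)}{b^{4}x^{5}}\,dx=\int\left(\frac{30b\kappa_0}{\sqrt{bx}}+\frac{120b\kappa_1}{(bx)^{3/2}}+\frac{240b\kappa_2}{(bx)^{5/2}}+5b\sqrt{bx}\,\kappa_0+b(bx)^{3/2}\kappa_1\right)dx$$ $$=\int\left(\frac{30E}x+\frac{120\left(\frac1{bx}+1\right)E}{bx^{2}}+\frac{240\left(\frac3{b^{2}x^{2}}+\frac3{bx}+1\right)E}{b^{2}x^{3}}+5bE+b^{2}x\left(\frac1{bx}+1\right)E\right)dx$$ $$=\Upsilon(1)+\frac{24}b\Upsilon(2)+\frac{24}{b^{2}}\Upsilon(3)+3bV(0,0)+bV(1,1).$$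
   Context: $\Gamma(s,z)=\int_z^\infty t^{s-1}e^{-t}dt$ is the upper incomplete gamma function, $K_\mu$ the Macdonald function (modified Bessel function of the second kind), and $\operatorname{erf}(z)=\frac{2}{\sqrt\pi}\int_0^z e^{-t^2}dt$. For $x>0$, $$\Upsilon(\upsilon,a,b,x)=\int\frac{e^{-ax^{2}-bx}}{x^{\upsilon}}dx=\sum_{k=0}^{\infty}\left(\frac{b^{2k+1}a^{-k+\frac{\upsilon}{2}-1}\Gamma\left(k-\frac{\upsilon}{2}+1,ax^{2}\right)}{2(2k+1)!}-\frac{b^{2k}a^{-k+\frac{\upsilon}{2}-\frac12}\Gamma\left(k-\frac{\upsilon}{2}+\frac12,ax^{2}\right)}{2(2k)!}\right).$$ With $W=\sqrt\pi\,e^{\frac{b^{2}}{4a}}\operatorname{erf}\left(\frac{2ax+b}{2\sqrt a}\right)$, $$V(0,0)=\int e^{-ax^{2}-bx}dx=\frac{W}{2\sqrt a},\qquad V(1,1)=b\int x\left(\frac1{bx}+1\right)e^{-ax^{2}-bx}dx=\frac{(2a-b^{2})W}{4a^{3/2}}-\frac{b\,e^{-ax^{2}-bx}}{2a}.$$ Roots are read with $\sqrt{bx}=\sqrt b\sqrt x$. All equalities are between indefinite integrals in $x$, i.e. up to additive constants.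
   Formalization: The last closed form, for Γ(7,bx)/(b⁴x⁵), is false as printed (its derivative lacks the 720E/(b⁴x⁵) term); it is corrected to 30Υ(1)+(120/b)Υ(2)+(360/b²)Υ(3)+(720/b³)Υ(4)+(720/b⁴)Υ(5)+5bV(0,0)+bV(1,1). b is any nonzero complex number. *)

theory Defs
  imports "HOL-Complex_Analysis.Complex_Analysis"
begin

(* The contour from z to infinity is the horizontal ray t = z + u, u >= 0, and t powr (s - 1) is
   the principal branch.  For real z > 0 this is the usual real integral; for s = 1, 2, ... the
   integrand is entire and the value is the entire function Gamma(s, z) for every complex z. *)
definition upper_Gamma :: "complex \<Rightarrow> complex \<Rightarrow> complex" where
  "upper_Gamma s z =
     integral {0..} (\<lambda>u::real. (z + of_real u) powr (s - 1) * exp (- (z + of_real u)))"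

definition erf :: "complex \<Rightarrow> complex" where
  "erf z = of_real (2 / sqrt pi) * contour_integral (linepath 0 z) (\<lambda>t. exp (- t\<^sup>2))"

definition bessel_I :: "complex \<Rightarrow> complex \<Rightarrow> complex" where
  "bessel_I \<nu> z =
     (z / 2) powr \<nu> * (\<Sum>k. (z\<^sup>2 / 4) ^ k / fact k * rGamma (\<nu> + of_nat k + 1))"

(* Principal branch, cut along the negative real axis; at integer orders by continuity in the
   order. *)
definition bessel_K :: "complex \<Rightarrow> complex \<Rightarrow> complex" where
  "bessel_K \<mu> z =
     (let K = (\<lambda>\<nu>. of_real (pi / 2) * (bessel_I (- \<nu>) z - bessel_I \<nu> z) / sin (\<nu> * of_real pi))
      in if \<mu> \<in> \<int> then Lim (at \<mu>) K else K \<mu>)"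

definition gauss_exp :: "real \<Rightarrow> complex \<Rightarrow> real \<Rightarrow> complex" where
  "gauss_exp a b x = exp (- of_real (a * x\<^sup>2) - b * of_real x)"

definition kappa :: "real \<Rightarrow> complex \<Rightarrow> nat \<Rightarrow> real \<Rightarrow> complex" where
  "kappa a b j x =
     of_real (sqrt (2 / pi) * exp (- a * x\<^sup>2)) * bessel_K (of_nat j + 1 / 2) (b * of_real x)"

(* The root of b x; (b x) to the power m/2 is read as its m-th power. *)
definition root_bx :: "complex \<Rightarrow> real \<Rightarrow> complex" where
  "root_bx b x = csqrt b * of_real (sqrt x)"

definition Upsilon :: "real \<Rightarrow> real \<Rightarrow> complex \<Rightarrow> real \<Rightarrow> complex" where
  "Upsilon \<upsilon> a b x =
     (\<Sum>k. b ^ (2 * k + 1) * of_real (a powr (- real k + \<upsilon> / 2 - 1))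
            * upper_Gamma (of_real (real k - \<upsilon> / 2 + 1)) (of_real (a * x\<^sup>2))
            / (2 * fact (2 * k + 1))
          - b ^ (2 * k) * of_real (a powr (- real k + \<upsilon> / 2 - 1 / 2))
            * upper_Gamma (of_real (real k - \<upsilon> / 2 + 1 / 2)) (of_real (a * x\<^sup>2))
            / (2 * fact (2 * k)))"

definition W :: "real \<Rightarrow> complex \<Rightarrow> real \<Rightarrow> complex" where
  "W a b x = of_real (sqrt pi) * exp (b\<^sup>2 / (4 * of_real a))
     * erf ((2 * of_real a * of_real x + b) / (2 * of_real (sqrt a)))"

definition V00 :: "real \<Rightarrow> complex \<Rightarrow> real \<Rightarrow> complex" where
  "V00 a b x = W a b x / (2 * of_real (sqrt a))"

definition V11 :: "real \<Rightarrow> complex \<Rightarrow> real \<Rightarrow> complex" where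
  "V11 a b x = (2 * of_real a - b\<^sup>2) * W a b x / (4 * of_real (a powr (3 / 2)))
     - b * gauss_exp a b x / (2 * of_real a)"

(* The indefinite integral of f over x > 0 is the set of all antiderivatives of f there; values at
   x <= 0 are irrelevant.  An equation "integral of f = F" up to an additive constant becomes
   antiderivatives f = plus_const F. *)
definition antiderivatives :: "(real \<Rightarrow> complex) \<Rightarrow> (real \<Rightarrow> complex) set" where
  "antiderivatives f = {F. \<forall>x>0. (F has_vector_derivative f x) (at x)}"

definition plus_const :: "(real \<Rightarrow> complex) \<Rightarrow> (real \<Rightarrow> complex) set" where
  "plus_const F = {G. \<exists>c. \<forall>x>0. G x = F x + c}"

end

theory Submission
  imports Defs
begin

text \<open>
  On the positive half-line all three integrands of a line agree pointwise with a Laurent polynomial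
  in \<open>x\<close> times \<open>E\<close>: \<open>\<Gamma>(n + 1, z)\<close> is \<open>exp (- z)\<close> times a polynomial, and
  \<open>K\<^bsub>j + 1/2\<^esub>\<close> is elementary by the three-term recurrence from \<open>K\<^bsub>1/2\<^esub>\<close>. It remains to
  differentiate the right-hand sides. The terms of \<open>\<Upsilon>(\<upsilon>)\<close> have as derivatives the terms of
  \<open>exp (- a x\<^sup>2) / x\<^sup>\<upsilon>\<close> times the exponential series of \<open>- b x\<close>, taken in
  consecutive pairs, so the derivative of \<open>\<Upsilon>(\<upsilon>)\<close> is \<open>E / x\<^sup>\<upsilon>\<close> once
  \<open>\<Gamma>(k + 1 - \<upsilon> / 2, z) = O(k!)\<close> gives convergence of the series itself.
\<close>

section \<open>The upper incomplete gamma function\<close>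

text \<open>The series \<open>Upsilon\<close> comes from expanding exp (- b x) and integrating term
  by term: with t = a x^2 and 2 s = m - \<upsilon> + 1, an antiderivative of x^(m - \<upsilon>) exp
  (- a x^2) is - a^(- s) Gamma(s, a x^2) / 2. The orders k - \<upsilon>/2 + 1 and k - \<upsilon>/2 +
  1/2 belong to m = 2k + 1 and m = 2k, and the signs are those of (- b)^m. For \<upsilon> up to 5
  the first orders can be zero or negative, and half of all orders are not integers, so no closed
  form of Gamma(s, z) is available there. The estimate behind convergence therefore has to hold for
  every real s; it compares with the integer order n + 1 for some n >= s - 1. The resulting k! is
  beaten by the (2k)! in the denominators. For complex b, all branch questions sit in one place: K
  of half-integer order carries the factor 1 / \<open>csqrt\<close> (b x), and
  \<open>root_bx\<close> is that same root, so each product in the integrands is rational in x times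
  E.\<close>

lemma has_integral_power_exp_Ici:
  "((\<lambda>u::real. u ^ k * exp (- u)) has_integral fact k) {0..}"
proof (rule has_integral_spike_finite)
  show "((\<lambda>u::real. u powr (real k + 1 - 1) / exp u) has_integral fact k) {0..}"
    using Gamma_integral_real[of "real k + 1"] by (simp add: Gamma_fact add.commute)
  \<comment> \<open>For k = 0 the integrands differ at the origin: \<open>0 powr 0 = 0\<close> but
    \<open>0 ^ 0 = 1\<close>.\<close>
  show "finite {0::real}" by simp
qed (simp_all add: powr_realpow exp_minus field_simps)

text \<open>Binomial expansion of (z + u)^n, with k! for the integral of u^k exp (- u). The field is
  left general because complex z gives \<open>upper_Gamma\<close> at positive integers, while real z
  gives the majorant for arbitrary real order.\<close>

lemma has_integral_shifted_power_exp:
  fixes z :: "'a::{real_normed_field,banach}"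
  shows "((\<lambda>u. (z + of_real u) ^ n * exp (- (z + of_real u)))
    has_integral exp (- z) * (\<Sum>k\<le>n. of_nat (n choose k) * fact k * z ^ (n - k))) {0..}"
proof -
  have "((\<lambda>u. of_real (u ^ k * exp (- u)) :: 'a) has_integral fact k) {0..}" for k
    using has_integral_linear[OF has_integral_power_exp_Ici bounded_linear_of_real, of k]
    by (simp add: o_def)
  then have "((\<lambda>u. exp (- z) * (\<Sum>k\<le>n. of_nat (n choose k) * z ^ (n - k) * of_real (u ^ k * exp (- u))))
    has_integral exp (- z) * (\<Sum>k\<le>n. of_nat (n choose k) * z ^ (n - k) * fact k)) {0..}"
    by (intro has_integral_mult_right has_integral_sum) auto
  moreover have "exp (- z) * (\<Sum>k\<le>n. of_nat (n choose k) * z ^ (n - k) * of_real (u ^ k * exp (- u)))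
      = (z + of_real u) ^ n * exp (- (z + of_real u))" for u :: real
  proof -
    have "exp (- (z + of_real u)) = exp (- z) * of_real (exp (- u))"
      by (simp add: exp_diff exp_minus exp_of_real divide_inverse)
    moreover have "(z + of_real u) ^ n = (\<Sum>k\<le>n. of_nat (n choose k) * z ^ (n - k) * of_real (u ^ k))"
      by (simp add: add.commute[of z] binomial_ring mult_ac)
    ultimately show ?thesis
      by (simp add: sum_distrib_left sum_distrib_right mult_ac)
  qed
  ultimately show ?thesis
    by (simp add: mult_ac)
qed

lemma upper_Gamma_of_nat:
  assumes "s = of_nat (Suc n)"
  shows "upper_Gamma s z = exp (- z) * (\<Sum>k\<le>n. of_nat (n choose k) * fact k * z ^ (n - k))"
  unfolding upper_Gamma_def
proof (intro integral_unique has_integral_spike_finite[OF _ _ has_integral_shifted_power_exp])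
  \<comment> \<open>The ray from z meets the origin in at most this one parameter. Everywhere else
    \<open>powr\<close> with a natural exponent is the ordinary power, so the branch cut has no
    effect.\<close>
  show "finite {- Re z}" by simp
  fix u assume "u \<in> {0..} - {- Re z}"
  then have "z + of_real u \<noteq> 0"
    by (auto simp: complex_eq_iff)
  then show "(z + of_real u) powr (s - 1) * exp (- (z + of_real u))
      = (z + of_real u) ^ n * exp (- (z + of_real u))"
    using powr_nat'[of "z + of_real u" n] by (simp add: assms)
qed

text \<open>Since (n choose k) k! = n! / (n - k)!, the sum is n! times a partial sum of the series
  of exp z, whose terms are nonnegative here.\<close>

lemma exp_neg_times_power_sum_le_fact:
  fixes z :: real
  assumes "z \<ge> 0"
  shows "exp (- z) * (\<Sum>k\<le>n. of_nat (n choose k) * fact k * z ^ (n - k)) \<le> fact n"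
proof -
  have "(\<Sum>k\<le>n. of_nat (n choose k) * fact k * z ^ (n - k)) = (\<Sum>k\<le>n. fact n * (z ^ (n - k) / fact (n - k)))"
    by (intro sum.cong) (auto simp: binomial_fact)
  also have "\<dots> = fact n * (\<Sum>k\<le>n. z ^ k / fact k)"
    by (subst sum.nat_diff_reindex[symmetric, of "\<lambda>k. z ^ k / fact k" "Suc n", unfolded lessThan_Suc_atMost])
       (simp add: sum_distrib_left)
  also have "(\<Sum>k\<le>n. z ^ k / fact k) \<le> exp z"
  proof -
    have "summable (\<lambda>k. z ^ k / fact k)"
      using summable_exp[of z] by (simp add: field_simps)
    moreover have "exp z = (\<Sum>k. z ^ k / fact k)"
      by (simp add: exp_def divide_inverse mult.commute)
    ultimately show ?thesis
      using assms by (simp add: sum_le_suminf)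
  qed
  finally have "(\<Sum>k\<le>n. of_nat (n choose k) * fact k * z ^ (n - k)) \<le> fact n * exp z"
    by simp
  then show ?thesis
    by (simp add: exp_minus field_simps)
qed

text \<open>On t >= z the factor t^(s - 1 - n) has exponent at most 0, hence is at most z^(s - 1 -
  n). This bounds the integrand by a multiple of t^n exp (- t), whose integral is known, whatever
  the sign of s. Rewriting the ray integral over \<open>{z..}\<close> prepares differentiation in
  the endpoint.\<close>

lemma upper_Gamma_real_integral:
  fixes s z :: real
  assumes z: "z > 0" and n: "s - 1 \<le> real n"
  defines "f \<equiv> \<lambda>t. t powr (s - 1) * exp (- t)"
  shows "f integrable_on {z..}"
    and "upper_Gamma (of_real s) (of_real z) = of_real (integral {z..} f)"
    and "\<bar>integral {z..} f\<bar> \<le> z powr (s - 1 - n) * fact n"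
proof -
  define g where "g = (\<lambda>u. z powr (s - 1 - n) * ((z + u) ^ n * exp (- (z + u))))"
  define I where "I = exp (- z) * (\<Sum>k\<le>n. of_nat (n choose k) * fact k * z ^ (n - k))"
  have g: "(g has_integral (z powr (s - 1 - n) * I)) {0..}"
    unfolding g_def I_def
    using has_integral_mult_right[OF has_integral_shifted_power_exp[of z n]] by simp
  have fg: "f (z + u) \<le> g u" if "u \<ge> 0" for u
  proof -
    have "(z + u) powr (s - 1) = (z + u) powr (s - 1 - n) * (z + u) ^ n"
      using z that by (simp add: powr_diff powr_realpow)
    also have "\<dots> \<le> z powr (s - 1 - n) * (z + u) ^ n"
      using z that n by (intro mult_right_mono powr_mono2') auto
    finally have "(z + u) powr (s - 1) * exp (- (z + u))
        \<le> z powr (s - 1 - n) * (z + u) ^ n * exp (- (z + u))"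
      by (rule mult_right_mono) simp
    then show ?thesis unfolding f_def g_def by (simp only: mult.assoc)
  qed
  \<comment> \<open>The change of variables u -> z + u below takes absolute integrability; it
    follows from measurability and the majorant \<open>g\<close>, as \<open>f\<close> is
    nonnegative.\<close>
  have "(\<lambda>u. f (z + u)) absolutely_integrable_on {0..}"
  proof (rule measurable_bounded_by_integrable_imp_absolutely_integrable)
    have "continuous_on {0..} (\<lambda>u. f (z + u))"
      unfolding f_def using z by (intro continuous_intros) auto
    then show "(\<lambda>u. f (z + u)) \<in> borel_measurable (lebesgue_on {0..})"
      by (intro continuous_imp_measurable_on_sets_lebesgue) auto
    show "g integrable_on {0..}" using g by blast
  qed (use fg in \<open>auto simp: f_def\<close>)
  moreover have "(+) z ` {0..} = {z..}"
    by simp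
  moreover have "((+) z has_field_derivative 1) (at x within {0..})" for x
    by (auto intro!: derivative_eq_intros)
  ultimately have ai: "f absolutely_integrable_on {z..}"
    and eq: "integral {z..} f = integral {0..} (\<lambda>u. f (z + u))"
    using has_absolute_integral_change_of_variables_1'[of "{0..}" "(+) z" "\<lambda>_. 1" f
      "integral {0..} (\<lambda>u. f (z + u))"] by auto
  show "f integrable_on {z..}"
    using ai by (rule set_lebesgue_integral_eq_integral(1))
  have fi: "(\<lambda>u. f (z + u)) integrable_on {0..}"
    using \<open>(\<lambda>u. f (z + u)) absolutely_integrable_on {0..}\<close> by (rule set_lebesgue_integral_eq_integral(1))
  have "upper_Gamma (of_real s) (of_real z) = integral {0..} (\<lambda>u. complex_of_real (f (z + u)))"
    unfolding upper_Gamma_def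
  proof (rule integral_cong)
    fix u :: real assume "u \<in> {0..}"
    then show "(of_real z + of_real u) powr (of_real s - 1) * exp (- (of_real z + of_real u))
        = complex_of_real (f (z + u))"
      using z powr_of_real[of "z + u" "s - 1"] by (simp add: f_def flip: exp_of_real)
  qed
  also have "\<dots> = of_real (integral {0..} (\<lambda>u. f (z + u)))"
    using has_integral_linear[OF integrable_integral[OF fi] bounded_linear_of_real]
    by (intro integral_unique) (simp add: o_def)
  finally show "upper_Gamma (of_real s) (of_real z) = of_real (integral {z..} f)"
    by (simp add: eq)
  have "integral {0..} (\<lambda>u. f (z + u)) \<le> z powr (s - 1 - n) * I"
    using fi fg g by (intro integral_le[THEN order_trans[OF _ eq_refl[OF integral_unique[OF g]]]]) auto
  moreover have "integral {0..} (\<lambda>u. f (z + u)) \<ge> 0"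
    using fi by (intro integral_nonneg) (auto simp: f_def)
  moreover have "I \<le> fact n"
    unfolding I_def using z by (intro exp_neg_times_power_sum_le_fact) simp
  ultimately show "\<bar>integral {z..} f\<bar> \<le> z powr (s - 1 - n) * fact n"
    unfolding eq by (smt (verit) mult_left_mono powr_ge_zero)
qed

lemma norm_upper_Gamma_le:
  fixes s z :: real
  assumes "z > 0" and "s - 1 \<le> real n"
  shows "norm (upper_Gamma (of_real s) (of_real z)) \<le> z powr (s - 1 - n) * fact n"
  using upper_Gamma_real_integral[OF assms] by simp

text \<open>Near z, Gamma(s, y) is the constant integral over \<open>{z / 2..}\<close> minus a
  proper integral from z/2 to y, to which the fundamental theorem of calculus applies. The base
  point z/2 is positive and leaves z in the interior.\<close>

lemma has_vector_derivative_upper_Gamma: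
  fixes s z :: real
  assumes z: "z > 0"
  shows "((\<lambda>z. upper_Gamma (of_real s) (of_real z)) has_vector_derivative
    of_real (- (z powr (s - 1) * exp (- z)))) (at z)"
proof -
  define f where "f = (\<lambda>t::real. t powr (s - 1) * exp (- t))"
  obtain n where n: "s - 1 \<le> real n"
    using real_arch_simple by blast
  note aux = upper_Gamma_real_integral[OF _ n, folded f_def]
  have cont: "continuous_on {z / 2..2 * z} f"
    unfolding f_def using z by (intro continuous_intros) auto
  have "((\<lambda>y. integral {z / 2..y} f) has_vector_derivative f z) (at z within {z / 2..2 * z})"
    using z by (intro integral_has_vector_derivative cont) auto
  then have "((\<lambda>y. integral {z / 2..y} f) has_vector_derivative f z) (at z)"
    using z by (simp add: at_within_Icc_at)
  then have "((\<lambda>y. integral {z / 2..} f - integral {z / 2..y} f) has_vector_derivative - f z) (at z)"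
    by (auto intro!: derivative_eq_intros)
  then have "((\<lambda>y. of_real (integral {z / 2..} f - integral {z / 2..y} f) :: complex)
      has_vector_derivative of_real (- f z)) (at z)"
    by (rule bounded_linear.has_vector_derivative[OF bounded_linear_of_real])
  then have "((\<lambda>z. upper_Gamma (of_real s) (of_real z)) has_vector_derivative of_real (- f z)) (at z)"
  proof (rule has_vector_derivative_transform_within_open)
    show "open {z / 2<..}" "z \<in> {z / 2<..}" using z by auto
    fix y assume y: "y \<in> {z / 2<..}"
    have "(f has_integral integral {z / 2..y} f) {z / 2..y}"
      by (intro integrable_integral integrable_on_subinterval[OF aux(1)[of "z / 2"]]) (use z in auto)
    moreover have "(f has_integral integral {y..} f) {y..}"
      by (intro integrable_integral aux(1)) (use z y in auto)
    moreover have "negligible ({z / 2..y} \<inter> {y..})"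
      by (rule negligible_subset[of "{y}"]) auto
    moreover have "{z / 2..y} \<union> {y..} = {z / 2..}" using y by auto
    ultimately have "integral {z / 2..} f = integral {z / 2..y} f + integral {y..} f"
      using has_integral_Un[of f _ "{z / 2..y}" _ "{y..}"] by (intro integral_unique) simp
    then show "of_real (integral {z / 2..} f - integral {z / 2..y} f) = upper_Gamma (of_real s) (of_real y)"
      using aux(2)[of y] z y by simp
  qed
  then show ?thesis by (simp add: f_def)
qed

lemma upper_Gamma_numeral:
  "upper_Gamma 1 z = exp (- z)"
  "upper_Gamma 2 z = exp (- z) * (1 + z)"
  "upper_Gamma 3 z = exp (- z) * (2 + 2 * z + z ^ 2)"
  "upper_Gamma 4 z = exp (- z) * (6 + 6 * z + 3 * z ^ 2 + z ^ 3)"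
  "upper_Gamma 5 z = exp (- z) * (24 + 24 * z + 12 * z ^ 2 + 4 * z ^ 3 + z ^ 4)"
  "upper_Gamma 6 z = exp (- z) * (120 + 120 * z + 60 * z ^ 2 + 20 * z ^ 3 + 5 * z ^ 4 + z ^ 5)"
  "upper_Gamma 7 z = exp (- z) * (720 + 720 * z + 360 * z ^ 2 + 120 * z ^ 3 + 30 * z ^ 4 + 6 * z ^ 5 + z ^ 6)"
  using upper_Gamma_of_nat[of _ 0 z] upper_Gamma_of_nat[of _ 1 z] upper_Gamma_of_nat[of _ 2 z]
    upper_Gamma_of_nat[of _ 3 z] upper_Gamma_of_nat[of _ 4 z] upper_Gamma_of_nat[of _ 5 z]
    upper_Gamma_of_nat[of _ 6 z]
  by (simp_all add: atMost_nat_numeral binomial_fact fact_numeral)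

section \<open>Macdonald functions of half-integer order\<close>

lemma summable_bessel_I:
  fixes \<nu> w :: complex
  shows "summable (\<lambda>k. w ^ k / fact k * rGamma (\<nu> + of_nat k + 1))"
proof -
  \<comment> \<open>For k >= N this gives |\<nu> + k + 1| >= 2 |w|, so consecutive terms shrink at
    least by half. The relation between them is used in multiplied form through the entire
    \<open>rGamma\<close>, which avoids dividing by zero at negative integer \<nu>.\<close>
  obtain N where N: "norm \<nu> + 2 * norm w \<le> real N"
    using real_arch_simple by blast
  show ?thesis
  proof (rule summable_ratio_test[of "1/2" N])
    fix k assume k: "k \<ge> N"
    define r where "r = rGamma (\<nu> + of_nat (Suc k) + 1)"
    have r: "rGamma (\<nu> + of_nat k + 1) = (\<nu> + of_nat k + 1) * r"
      using rGamma_plus1[of "\<nu> + of_nat k + 1"] by (simp add: r_def add_ac)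
    have "norm (\<nu> + of_nat k + 1) \<ge> norm (of_nat (Suc k) :: complex) - norm \<nu>"
      using norm_diff_ineq[of "of_nat (Suc k) :: complex" \<nu>] by (simp add: add_ac)
    then have le: "norm w * 2 \<le> norm (\<nu> + of_nat k + 1)"
      using N k unfolding norm_of_nat by linarith
    have "norm w / real (Suc k) \<le> norm w" 
      by (simp add: field_simps)
    then have "norm w / real (Suc k) \<le> 1 / 2 * norm (\<nu> + of_nat k + 1)"
      using le by linarith
    then have "norm w ^ k / fact k * (norm w / real (Suc k)) * norm r
        \<le> norm w ^ k / fact k * (1 / 2 * norm (\<nu> + of_nat k + 1)) * norm r"
      by (intro mult_right_mono mult_left_mono) auto
    moreover have "norm (w ^ Suc k / fact (Suc k) * r)
        = norm w ^ k / fact k * (norm w / real (Suc k)) * norm r"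
      by (simp add: norm_mult norm_divide norm_power mult_ac del: of_nat_Suc)
    moreover have "1 / 2 * norm (w ^ k / fact k * ((\<nu> + of_nat k + 1) * r))
        = norm w ^ k / fact k * (1 / 2 * norm (\<nu> + of_nat k + 1)) * norm r"
      by (simp only: norm_mult norm_divide norm_power norm_fact mult_ac)
    ultimately show "norm (w ^ Suc k / fact (Suc k) * rGamma (\<nu> + of_nat (Suc k) + 1))
        \<le> 1 / 2 * norm (w ^ k / fact k * rGamma (\<nu> + of_nat k + 1))"
      unfolding r r_def[symmetric] by simp
  qed simp
qed

text \<open>With c(\<nu>, k) the coefficients of the series and w = z^2/4, one has c(\<nu> - 1, k) =
  (\<nu> + k) c(\<nu>, k) and (k + 1) c(\<nu>, k + 1) = w c(\<nu> + 1, k). Summing gives S(\<nu> -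
  1) = \<nu> S(\<nu>) + w S(\<nu> + 1), and the powers of z/2 do the rest.\<close>

lemma bessel_I_recurrence:
  assumes "z \<noteq> 0"
  shows "bessel_I (\<nu> - 1) z - bessel_I (\<nu> + 1) z = 2 * \<nu> / z * bessel_I \<nu> z"
proof -
  define w where "w = z\<^sup>2 / 4"
  define c where "c = (\<lambda>\<nu> k. w ^ k / fact k * rGamma (\<nu> + of_nat k + 1))"
  have sm: "summable (c \<mu>)" for \<mu>
    unfolding c_def by (rule summable_bessel_I)
  have "(\<lambda>k. w * c (\<nu> + 1) k) sums (w * suminf (c (\<nu> + 1)))"
    by (intro sums_mult summable_sums sm)
  moreover have "w * c (\<nu> + 1) k = of_nat (Suc k) * c \<nu> (Suc k)" for k
  proof -
    have "\<nu> + 1 + of_nat k + 1 = \<nu> + of_nat (Suc k) + 1"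
      by simp
    then show ?thesis
      unfolding c_def by (simp only: fact_Suc power_Suc) (simp del: of_nat_Suc)
  qed
  \<comment> \<open>The term of index 0 vanishes, so the index shift leaves the sum
    unchanged.\<close>
  ultimately have "(\<lambda>k. of_nat k * c \<nu> k) sums (w * suminf (c (\<nu> + 1)))"
    using sums_Suc[of "\<lambda>k. of_nat k * c \<nu> k"] by simp
  moreover have "(\<lambda>k. \<nu> * c \<nu> k) sums (\<nu> * suminf (c \<nu>))"
    by (intro sums_mult summable_sums sm)
  ultimately have "(\<lambda>k. \<nu> * c \<nu> k + of_nat k * c \<nu> k) sums (\<nu> * suminf (c \<nu>) + w * suminf (c (\<nu> + 1)))"
    by (rule sums_add[rotated])
  moreover have "\<nu> * c \<nu> k + of_nat k * c \<nu> k = c (\<nu> - 1) k" for k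
  proof -
    have "c (\<nu> - 1) k = w ^ k / fact k * rGamma (\<nu> + of_nat k)"
      by (simp add: c_def)
    also have "\<dots> = (\<nu> + of_nat k) * c \<nu> k"
      unfolding c_def rGamma_plus1[of "\<nu> + of_nat k", symmetric] by (simp only: mult_ac)
    finally show ?thesis
      by (simp only: ring_distribs)
  qed
  ultimately have J: "suminf (c (\<nu> - 1)) = \<nu> * suminf (c \<nu>) + w * suminf (c (\<nu> + 1))"
    by (simp only: sums_iff)
  have p: "(z / 2) powr (\<nu> + 1) = (z / 2) powr \<nu> * (z / 2)" "(z / 2) powr (\<nu> - 1) = (z / 2) powr \<nu> / (z / 2)"
    using assms by (simp_all add: powr_add powr_diff)
  have I: "bessel_I \<mu> z = (z / 2) powr \<mu> * suminf (c \<mu>)" for \<mu>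
    by (simp only: bessel_I_def c_def w_def)
  have "P / (z / 2) * (\<nu> * A + w * B) - P * (z / 2) * B = 2 * \<nu> / z * (P * A)" for P A B :: complex
    using assms by (simp add: w_def field_simps power2_eq_square)
  then show ?thesis
    by (simp only: I J p)
qed

text \<open>The duplication formula at half-integers; it turns the Bessel series of orders -1/2 and
  1/2 into those of cosh and sinh.\<close>

lemma rGamma_half_plus_nat:
  "rGamma (1 / 2 + of_nat k :: complex) = 4 ^ k * fact k / (fact (2 * k) * of_real (sqrt pi))"
proof (induction k)
  case 0
  show ?case by (simp add: rGamma_inverse_Gamma Gamma_one_half_complex inverse_eq_divide)
next
  case (Suc k)
  have nz: "(1 / 2 + of_nat k :: complex) \<noteq> 0"
    by (auto simp: complex_eq_iff)
  have "rGamma (1 / 2 + of_nat (Suc k) :: complex) = rGamma (1 / 2 + of_nat k) / (1 / 2 + of_nat k)"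
    using rGamma_plus1[of "1 / 2 + of_nat k :: complex"] nz by (simp add: field_simps add_ac)
  also have "\<dots> = 4 ^ Suc k * fact (Suc k) / (fact (2 * Suc k) * of_real (sqrt pi))"
  proof -
    have "(fact (2 * Suc k) :: complex) = 4 * (1 + of_nat k) * (1 / 2 + of_nat k) * fact (2 * k)"
      by (simp add: field_simps)
    moreover have "(1 + of_nat k :: complex) \<noteq> 0"
      by (metis of_nat_Suc of_nat_neq_0)
    ultimately show ?thesis
      unfolding Suc using nz by (simp add: divide_simps del: fact_Suc) (simp add: field_simps)
  qed
  finally show ?case .
qed

lemma bessel_I_neg_half:
  "bessel_I (- (1 / 2)) z = (z / 2) powr (- (1 / 2)) * cosh z / of_real (sqrt pi)"
proof -
  \<comment> \<open>\<open>cosh_converges\<close> runs over all indices with zeros at the odd ones;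
    reindexing by doubling drops the zeros.\<close>
  have "(\<lambda>k. z ^ (2 * k) / fact (2 * k)) sums cosh z"
    by (rule iffD1[OF sums_cong iffD2[OF sums_mono_reindex[of "(*) 2"] cosh_converges[of z]]])
       (auto simp: strict_mono_def scaleR_conv_of_real divide_inverse mult.commute[of 2] elim!: evenE)
  then have "(\<lambda>k. z ^ (2 * k) / fact (2 * k) / of_real (sqrt pi)) sums (cosh z / of_real (sqrt pi))"
    by (rule sums_divide)
  moreover have "(z\<^sup>2 / 4) ^ k / fact k * rGamma (- (1 / 2) + of_nat k + 1)
      = z ^ (2 * k) / fact (2 * k) / of_real (sqrt pi)" for k
    using rGamma_half_plus_nat[of k] by (simp add: algebra_simps power_divide flip: power_mult)
  ultimately have "(\<Sum>k. (z\<^sup>2 / 4) ^ k / fact k * rGamma (- (1 / 2) + of_nat k + 1)) = cosh z / of_real (sqrt pi)"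
    by (simp only: sums_iff)
  then show ?thesis
    unfolding bessel_I_def by simp
qed

text \<open>The prefactor is written with exponent -1/2, as in \<open>bessel_I_neg_half\<close>, so
  that the difference of the two functions contains cosh z - sinh z = exp (- z).\<close>

lemma bessel_I_half:
  assumes "z \<noteq> 0"
  shows "bessel_I (1 / 2) z = (z / 2) powr (- (1 / 2)) * sinh z / of_real (sqrt pi)"
proof -
  have "(\<lambda>k. z ^ (2 * k + 1) / fact (2 * k + 1)) sums sinh z"
  proof -
    have "(\<lambda>k. if even (2 * k + 1) then 0 else z ^ (2 * k + 1) /\<^sub>R fact (2 * k + 1)) sums sinh z"
      by (rule iffD2[OF sums_mono_reindex[of "\<lambda>k. 2 * k + 1"] sinh_converges[of z]])
         (auto simp: strict_mono_def elim!: oddE)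
    moreover have "z ^ n /\<^sub>R fact n = z ^ n / fact n" for n
      by (simp add: scaleR_conv_of_real divide_inverse mult.commute)
    ultimately show ?thesis
      by (simp del: fact_Suc power_Suc)
  qed
  then have "(\<lambda>k. 2 / (z * of_real (sqrt pi)) * (z ^ (2 * k + 1) / fact (2 * k + 1)))
      sums (2 / (z * of_real (sqrt pi)) * sinh z)"
    by (rule sums_mult)
  moreover have "(z\<^sup>2 / 4) ^ k / fact k * rGamma (1 / 2 + of_nat k + 1)
      = 2 / (z * of_real (sqrt pi)) * (z ^ (2 * k + 1) / fact (2 * k + 1))" for k
  proof -
    have "rGamma (1 / 2 + of_nat k + 1 :: complex) = rGamma (1 / 2 + of_nat k) / (1 / 2 + of_nat k)"
      using rGamma_plus1[of "1 / 2 + of_nat k :: complex"]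
      by (auto simp: field_simps complex_eq_iff)
    also have "\<dots> = 2 * 4 ^ k * fact k / (fact (2 * k + 1) * of_real (sqrt pi))"
      unfolding rGamma_half_plus_nat by (simp add: field_simps)
    finally show ?thesis
      using assms by (simp add: field_simps power_divide del: fact_Suc flip: power_mult)
  qed
  ultimately have "(\<Sum>k. (z\<^sup>2 / 4) ^ k / fact k * rGamma (1 / 2 + of_nat k + 1))
      = 2 / (z * of_real (sqrt pi)) * sinh z"
    by (simp only: sums_iff)
  moreover have "(z / 2) powr (1 / 2) = (z / 2) powr (- (1 / 2)) * (z / 2)"
    using assms powr_add[of "z / 2" "- (1 / 2)" 1] by simp
  ultimately show ?thesis
    unfolding bessel_I_def using assms by (simp only:) simp
qed

lemma bessel_K_non_Ints:
  assumes "\<nu> \<notin> \<int>"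
  shows "bessel_K \<nu> z = of_real (pi / 2) * (bessel_I (- \<nu>) z - bessel_I \<nu> z) / sin (\<nu> * of_real pi)"
  using assms by (simp add: bessel_K_def Let_def)

text \<open>Numerator and sine are both odd in \<nu>.\<close>

lemma bessel_K_minus:
  assumes "\<nu> \<notin> \<int>"
  shows "bessel_K (- \<nu>) z = bessel_K \<nu> z"
  using assms by (simp add: bessel_K_non_Ints minus_in_Ints_iff divide_simps) (simp add: algebra_simps)

text \<open>The recurrences of I at \<nu> and - \<nu> are subtracted. Shifting the order by one
  changes the sign of the sine in the denominator, which turns the minus sign of the I recurrence
  into a plus.\<close>

lemma bessel_K_recurrence:
  assumes \<nu>: "\<nu> \<notin> \<int>" and z: "z \<noteq> 0"
  shows "bessel_K (\<nu> + 1) z = bessel_K (\<nu> - 1) z + 2 * \<nu> / z * bessel_K \<nu> z"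
proof -
  have ni: "\<nu> + 1 \<notin> \<int>" "\<nu> - 1 \<notin> \<int>"
    using \<nu> Ints_diff[of "\<nu> + 1" 1] Ints_add[of "\<nu> - 1" 1] by auto
  have s: "sin ((\<nu> + 1) * of_real pi) = - sin (\<nu> * of_real pi)"
    "sin ((\<nu> - 1) * of_real pi) = - sin (\<nu> * of_real pi)"
    by (simp_all add: algebra_simps sin_add sin_diff flip: sin_of_real cos_of_real)
  have r: "bessel_I (\<nu> + 1) z = bessel_I (\<nu> - 1) z - 2 * \<nu> / z * bessel_I \<nu> z"
    "bessel_I (- (\<nu> + 1)) z = bessel_I (- (\<nu> - 1)) z - 2 * \<nu> / z * bessel_I (- \<nu>) z"
    using bessel_I_recurrence[OF z, of \<nu>] bessel_I_recurrence[OF z, of "- \<nu>"]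
    by (simp_all add: algebra_simps minus_diff_commute)
  show ?thesis
    unfolding bessel_K_non_Ints[OF ni(1)] bessel_K_non_Ints[OF ni(2)] bessel_K_non_Ints[OF \<nu>] s r
    by (simp add: diff_divide_distrib add_divide_distrib algebra_simps)
qed

text \<open>Keeps the orders of \<open>kappa\<close> out of the limit case in
  \<open>bessel_K_def\<close>.\<close>

lemma half_plus_nat_non_Ints: "of_nat n + 1 / 2 \<notin> (\<int> :: complex set)"
proof
  assume "of_nat n + 1 / 2 \<in> (\<int> :: complex set)"
  then obtain m where "of_nat n + 1 / 2 = (of_int m :: complex)" by (auto elim: Ints_cases)
  then have "of_int (2 * int n + 1) = (of_int (2 * m) :: complex)" by (simp add: field_simps)
  then have "2 * int n + 1 = 2 * m" by (simp only: of_int_eq_iff)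
  then show False by presburger
qed

lemma bessel_K_half:
  assumes "z \<noteq> 0"
  shows "bessel_K (1 / 2) z = of_real (sqrt (pi / 2)) * exp (- z) / csqrt z"
proof -
  \<comment> \<open>A positive factor does not change the argument, so the principal root is
    multiplicative here, even on the cut.\<close>
  have "csqrt (of_real 2 * (z / 2)) = csqrt (of_real 2) * csqrt (z / 2)"
    by (rule csqrt_mult) (use Arg_bounded in \<open>auto simp: Arg_of_real\<close>)
  then have c: "csqrt z = of_real (sqrt 2) * csqrt (z / 2)" by simp
  have p: "(z / 2) powr (- (1 / 2)) = of_real (sqrt 2) / csqrt z"
  proof -
    have "(z / 2) powr (- (1 / 2)) = inverse (csqrt (z / 2))"
      by (simp only: powr_minus csqrt_conv_powr)
    also have "csqrt (z / 2) = csqrt z / of_real (sqrt 2)"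
      by (simp add: c)
    finally show ?thesis by simp
  qed
  have s: "sin (of_real pi / 2 :: complex) = 1"
    using sin_of_real[of "pi / 2", where ?'a = complex] by simp
  have "bessel_K (1 / 2) z = of_real (pi / 2) * ((z / 2) powr (- (1 / 2)) * (cosh z - sinh z) / of_real (sqrt pi))"
    using assms half_plus_nat_non_Ints[of 0] s
    by (simp add: bessel_K_non_Ints bessel_I_half bessel_I_neg_half diff_divide_distrib right_diff_distrib)
  also have "\<dots> = of_real (pi / 2 * sqrt 2 / sqrt pi) * exp (- z) / csqrt z"
    unfolding p cosh_minus_sinh by (simp add: mult_ac)
  also have "pi / 2 * sqrt 2 / sqrt pi = sqrt (pi / 2)"
  proof -
    have "pi / 2 * sqrt 2 / sqrt pi = (pi / sqrt pi) * (sqrt 2 / 2)"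
      by simp
    also have "\<dots> = sqrt pi / sqrt 2"
    proof -
      have "sqrt 2 / 2 = 1 / sqrt (2 :: real)" by (simp add: field_simps)
      moreover have "pi / sqrt pi = sqrt pi" by (simp add: real_div_sqrt)
      ultimately show ?thesis by (simp only: times_divide_eq_right mult_1_right)
    qed
    finally show ?thesis
      by (simp only: real_sqrt_divide)
  qed
  finally show ?thesis .
qed

section \<open>The three forms of the integrands\<close>

lemma gauss_exp_split:
  "gauss_exp a b x = of_real (exp (- a * x\<^sup>2)) * exp (- (b * of_real x))"
proof -
  have "gauss_exp a b x = exp (of_real (- a * x\<^sup>2)) * exp (- (b * of_real x))"
    by (simp add: gauss_exp_def flip: exp_add)
  then show ?thesis by (simp only: exp_of_real)
qed

lemma exp_times_upper_Gamma_numeral: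
  "of_real (exp (- a * x\<^sup>2)) * upper_Gamma 1 (b * of_real x) = gauss_exp a b x"
  "of_real (exp (- a * x\<^sup>2)) * upper_Gamma 2 (b * of_real x)
    = (1 + b * of_real x) * gauss_exp a b x"
  "of_real (exp (- a * x\<^sup>2)) * upper_Gamma 3 (b * of_real x)
    = (2 + 2 * (b * of_real x) + (b * of_real x) ^ 2) * gauss_exp a b x"
  "of_real (exp (- a * x\<^sup>2)) * upper_Gamma 4 (b * of_real x)
    = (6 + 6 * (b * of_real x) + 3 * (b * of_real x) ^ 2 + (b * of_real x) ^ 3) * gauss_exp a b x"
  "of_real (exp (- a * x\<^sup>2)) * upper_Gamma 5 (b * of_real x)
    = (24 + 24 * (b * of_real x) + 12 * (b * of_real x) ^ 2 + 4 * (b * of_real x) ^ 3 + (b * of_real x) ^ 4) * gauss_exp a b x"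
  "of_real (exp (- a * x\<^sup>2)) * upper_Gamma 6 (b * of_real x)
    = (120 + 120 * (b * of_real x) + 60 * (b * of_real x) ^ 2 + 20 * (b * of_real x) ^ 3 + 5 * (b * of_real x) ^ 4 + (b * of_real x) ^ 5) * gauss_exp a b x"
  "of_real (exp (- a * x\<^sup>2)) * upper_Gamma 7 (b * of_real x)
    = (720 + 720 * (b * of_real x) + 360 * (b * of_real x) ^ 2 + 120 * (b * of_real x) ^ 3 + 30 * (b * of_real x) ^ 4 + 6 * (b * of_real x) ^ 5 + (b * of_real x) ^ 6) * gauss_exp a b x"
  unfolding gauss_exp_split upper_Gamma_numeral by (simp_all only: mult_ac mult_1_right)

text \<open>Identifies the prescribed reading of the root with the principal root appearing in
  \<open>bessel_K_half\<close>.\<close>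

lemma root_bx_eq_csqrt: "x > 0 \<Longrightarrow> root_bx b x = csqrt (b * of_real x)"
  unfolding root_bx_def
  by (subst csqrt_mult) (use Arg_bounded in \<open>auto simp: Arg_of_real\<close>)

context
  fixes a x :: real and b :: complex
  assumes x: "x > 0" and b: "b \<noteq> 0"
begin

lemma root_bx_square: "root_bx b x ^ 2 = b * of_real x"
  using x by (simp add: root_bx_def power_mult_distrib flip: of_real_power)

lemma root_bx_nonzero: "root_bx b x \<noteq> 0"
  using x b by (simp add: root_bx_def)

lemma kappa_0: "kappa a b 0 x = gauss_exp a b x / root_bx b x"
proof -
  have "sqrt (2 / pi) * sqrt (pi / 2) = 1"
    unfolding real_sqrt_mult[symmetric] by simp
  then have s: "of_real (sqrt (2 / pi)) * of_real (sqrt (pi / 2)) = (1 :: complex)"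
    by (metis of_real_1 of_real_mult)
  have "kappa a b 0 x = of_real (sqrt (2 / pi)) * of_real (sqrt (pi / 2))
      * (of_real (exp (- a * x\<^sup>2)) * exp (- (b * of_real x))) / root_bx b x"
    using x b by (simp add: kappa_def bessel_K_half root_bx_eq_csqrt mult_ac)
  then show ?thesis
    by (simp only: s gauss_exp_split mult_1)
qed

lemma kappa_1: "kappa a b 1 x = (1 + 1 / (b * of_real x)) * kappa a b 0 x"
proof -
  have "bessel_K (1 / 2 + 1) (b * of_real x) = bessel_K (1 / 2 - 1) (b * of_real x)
      + 2 * (1 / 2) / (b * of_real x) * bessel_K (1 / 2) (b * of_real x)"
    by (rule bessel_K_recurrence) (use half_plus_nat_non_Ints[of 0] x b in auto)
  \<comment> \<open>Evenness in the order closes the recurrence at \<nu> = 1/2: order -1/2 is order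
    1/2 again.\<close>
  moreover have "bessel_K (1 / 2 - 1) (b * of_real x) = bessel_K (1 / 2) (b * of_real x)"
    using bessel_K_minus[of "1 / 2"] half_plus_nat_non_Ints[of 0] by simp
  ultimately show ?thesis
    by (simp add: kappa_def algebra_simps)
qed

lemma kappa_2: "kappa a b 2 x = (1 + 3 / (b * of_real x) + 3 / (b * of_real x) ^ 2) * kappa a b 0 x"
proof -
  have "bessel_K (3 / 2 + 1) (b * of_real x) = bessel_K (3 / 2 - 1) (b * of_real x)
      + 2 * (3 / 2) / (b * of_real x) * bessel_K (3 / 2) (b * of_real x)"
    by (rule bessel_K_recurrence) (use half_plus_nat_non_Ints[of 1] x b in auto)
  then have "kappa a b 2 x = kappa a b 0 x + 3 / (b * of_real x) * kappa a b 1 x"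
    by (simp add: kappa_def algebra_simps)
  then show ?thesis
    unfolding kappa_1 by (simp add: algebra_simps power2_eq_square)
qed

end

lemma kappa_factor_root:
  assumes x: "x > 0" and b: "b \<noteq> 0"
  shows "kappa a b 0 x = root_bx b x * (gauss_exp a b x / (b * of_real x))"
    and "kappa a b 1 x = root_bx b x * ((1 + 1 / (b * of_real x)) * gauss_exp a b x / (b * of_real x))"
    and "kappa a b 2 x = root_bx b x * ((1 + 3 / (b * of_real x) + 3 / (b * of_real x) ^ 2) * gauss_exp a b x / (b * of_real x))"
proof -
  show k0: "kappa a b 0 x = root_bx b x * (gauss_exp a b x / (b * of_real x))"
    unfolding kappa_0[OF assms] root_bx_square[OF assms, symmetric]
    using root_bx_nonzero[OF assms] by (simp add: power2_eq_square)
  show "kappa a b 1 x = root_bx b x * ((1 + 1 / (b * of_real x)) * gauss_exp a b x / (b * of_real x))"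
    unfolding kappa_1[OF assms] k0 by (simp only: mult_ac times_divide_eq_right times_divide_eq_left)
  show "kappa a b 2 x = root_bx b x * ((1 + 3 / (b * of_real x) + 3 / (b * of_real x) ^ 2) * gauss_exp a b x / (b * of_real x))"
    unfolding kappa_2[OF assms] k0 by (simp only: mult_ac times_divide_eq_right times_divide_eq_left)
qed

text \<open>These are rewrite rules that eliminate every root from the integrands. Some come with
  and some without a leading coefficient \<open>c\<close>, following how the summands of the theorem
  parse.\<close>

lemma kappa_root_products:
  assumes x: "x > 0" and b: "b \<noteq> 0"
  shows "c * kappa a b 0 x / root_bx b x = c * gauss_exp a b x / (b * of_real x)"
    and "kappa a b 0 x / root_bx b x = gauss_exp a b x / (b * of_real x)"
    and "c * kappa a b 1 x / root_bx b x ^ 3 = c * (1 + 1 / (b * of_real x)) * gauss_exp a b x / (b * of_real x) ^ 2"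
    and "c * kappa a b 2 x / root_bx b x ^ 5
      = c * (1 + 3 / (b * of_real x) + 3 / (b * of_real x) ^ 2) * gauss_exp a b x / (b * of_real x) ^ 3"
    and "root_bx b x * kappa a b 0 x = gauss_exp a b x"
    and "c * root_bx b x * kappa a b 0 x = c * gauss_exp a b x"
    and "root_bx b x ^ 3 * kappa a b 1 x = (b * of_real x + 1) * gauss_exp a b x"
    and "c * root_bx b x ^ 3 * kappa a b 1 x = c * (b * of_real x + 1) * gauss_exp a b x"
proof -
  define r where "r = root_bx b x"
  \<comment> \<open>With b x written as r^2, each claim becomes a rational identity in r.\<close>
  have z: "b * of_real x = r ^ 2" and r: "r \<noteq> 0"
    using root_bx_square[OF assms] root_bx_nonzero[OF assms] by (simp_all add: r_def)
  note k = kappa_factor_root[OF assms, folded r_def, unfolded z]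
  show "c * kappa a b 0 x / root_bx b x = c * gauss_exp a b x / (b * of_real x)"
    and "kappa a b 0 x / root_bx b x = gauss_exp a b x / (b * of_real x)"
    and "c * kappa a b 1 x / root_bx b x ^ 3 = c * (1 + 1 / (b * of_real x)) * gauss_exp a b x / (b * of_real x) ^ 2"
    and "c * kappa a b 2 x / root_bx b x ^ 5
      = c * (1 + 3 / (b * of_real x) + 3 / (b * of_real x) ^ 2) * gauss_exp a b x / (b * of_real x) ^ 3"
    and "root_bx b x * kappa a b 0 x = gauss_exp a b x"
    and "c * root_bx b x * kappa a b 0 x = c * gauss_exp a b x"
    and "root_bx b x ^ 3 * kappa a b 1 x = (b * of_real x + 1) * gauss_exp a b x"
    and "c * root_bx b x ^ 3 * kappa a b 1 x = c * (b * of_real x + 1) * gauss_exp a b x"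
    unfolding r_def[symmetric] k z using r by (simp_all add: field_simps eval_nat_numeral)
qed

section \<open>Antiderivatives\<close>

text \<open>The substitution t = a x^2 contributes a^(s - 1) times a, which a^(- s) cancels. A
  separate \<open>p\<close> lets the exponents be used exactly as \<open>Upsilon\<close> writes
  them.\<close>

lemma powr_neg_mult_powr_scaled_square:
  fixes a x p s :: real
  assumes "a > 0" "x > 0" "p = - s"
  shows "a powr p * ((a * x\<^sup>2) powr (s - 1) * (2 * a * x)) = 2 * x powr (2 * s - 1)"
proof -
  have "(a * x\<^sup>2) powr (s - 1) = a powr (s - 1) * x powr (2 * s - 2)"
    using assms by (simp add: powr_mult powr_powr algebra_simps flip: powr_numeral)
  moreover have "a powr (- s) * a powr (s - 1) * a = 1"
    using assms by (simp add: powr_minus powr_diff)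
  moreover have "x powr (2 * s - 2) * x = x powr (2 * s - 1)"
    using assms powr_add[of x "2 * s - 2" 1] by simp
  moreover have "A * ((B * C) * (2 * a * x)) = (A * B * a) * (2 * (C * x))" for A B C
    by (simp only: mult_ac)
  ultimately show ?thesis
    by (simp only: assms(3) mult_1)
qed

lemma has_vector_derivative_scaled_upper_Gamma:
  fixes a x p s :: real
  assumes a: "a > 0" and x: "x > 0" and p: "p = - s"
  shows "((\<lambda>x. of_real (a powr p) * upper_Gamma (of_real s) (of_real (a * x\<^sup>2)))
    has_vector_derivative of_real (- 2 * x powr (2 * s - 1) * exp (- a * x\<^sup>2))) (at x)"
proof -
  have "((\<lambda>x. a * x\<^sup>2) has_vector_derivative 2 * a * x) (at x)"
    by (auto intro!: derivative_eq_intros simp flip: has_real_derivative_iff_has_vector_derivative)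
  then have "(((\<lambda>z. upper_Gamma (of_real s) (of_real z)) \<circ> (\<lambda>x. a * x\<^sup>2)) has_vector_derivative
      (2 * a * x) *\<^sub>R of_real (- ((a * x\<^sup>2) powr (s - 1) * exp (- (a * x\<^sup>2))))) (at x)"
    by (rule vector_diff_chain_at[OF _ has_vector_derivative_upper_Gamma]) (use a x in auto)
  then have "((\<lambda>x. of_real (a powr p) * upper_Gamma (of_real s) (of_real (a * x\<^sup>2))) has_vector_derivative
      of_real (a powr p) * ((2 * a * x) *\<^sub>R of_real (- ((a * x\<^sup>2) powr (s - 1) * exp (- (a * x\<^sup>2)))))) (at x)"
    unfolding o_def by (rule has_vector_derivative_mult_right)
  moreover have "a powr p * (2 * a * x * - ((a * x\<^sup>2) powr (s - 1) * exp (- (a * x\<^sup>2))))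
      = - 2 * x powr (2 * s - 1) * exp (- a * x\<^sup>2)"
    using powr_neg_mult_powr_scaled_square[OF assms] by (simp add: algebra_simps)
  ultimately show ?thesis
    by (metis of_real_mult scaleR_conv_of_real)
qed

text \<open>From (k!)^2 <= (2k)! the terms are at most |c|^k / k!. This series dominates both halves
  of \<open>Upsilon\<close>.\<close>

lemma summable_fact_mult_power_div_fact:
  fixes c :: real
  shows "summable (\<lambda>k. fact k * c ^ k / fact (2 * k))"
proof (rule summable_norm_cancel, rule summable_comparison_test')
  show "summable (\<lambda>k. inverse (fact k) * \<bar>c\<bar> ^ k)"
    by (rule summable_exp)
  fix k :: nat
  have "(fact k * fact k :: real) \<le> fact (2 * k)"
  proof -
    have "fact k * fact k dvd (fact (2 * k) :: nat)"
      using fact_fact_dvd_fact[of k k, where ?'a = nat] by (simp add: mult_2)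
    then have "fact k * fact k \<le> (fact (2 * k) :: nat)"
      by (rule dvd_imp_le) simp
    then have "of_nat (fact k * fact k) \<le> (of_nat (fact (2 * k)) :: real)"
      by (simp only: of_nat_le_iff)
    then show ?thesis by simp
  qed
  then have "fact k * fact k * \<bar>c\<bar> ^ k \<le> fact (2 * k) * \<bar>c\<bar> ^ k"
    by (rule mult_right_mono) simp
  then show "norm (norm (fact k * c ^ k / fact (2 * k))) \<le> inverse (fact k) * \<bar>c\<bar> ^ k"
    by (simp add: abs_mult power_abs field_simps)
qed

text \<open>Taking n = k makes the powers of a combine to a^(- k - 1). For s = k + const the
  exponent of x does not depend on k, so only a geometric factor and k! vary.\<close>

lemma norm_scaled_upper_Gamma_le:
  fixes a x p s :: real
  assumes a: "a > 0" and x: "x > 0" and s: "s - 1 \<le> real k"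
  shows "norm (of_real (a powr (- s)) * upper_Gamma (of_real s) (of_real (a * x\<^sup>2)))
    \<le> x powr (2 * (s - 1 - k)) / a * ((1 / a) ^ k * fact k)"
proof -
  have "norm (of_real (a powr (- s)) * upper_Gamma (of_real s) (of_real (a * x\<^sup>2)))
      \<le> a powr (- s) * ((a * x\<^sup>2) powr (s - 1 - k) * fact k)"
    unfolding norm_mult using norm_upper_Gamma_le[of "a * x\<^sup>2" s k] a x s
    by (simp add: mult_left_mono)
  also have "(a * x\<^sup>2) powr (s - 1 - k) = a powr (s - 1 - k) * x powr (2 * (s - 1 - k))"
    using a x by (simp add: powr_mult powr_powr flip: powr_numeral)
  also have "a powr (- s) * (a powr (s - 1 - k) * x powr (2 * (s - 1 - k)) * fact k)
      = (a powr (- s) * a powr (s - 1 - k)) * x powr (2 * (s - 1 - k)) * fact k"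
    by (simp only: mult_ac)
  also have "a powr (- s) * a powr (s - 1 - k) = (1 / a) ^ k / a"
  proof -
    have "a powr (- s) * a powr (s - 1 - k) = a powr (- real (Suc k))"
      by (simp flip: powr_add)
    also have "\<dots> = (1 / a) ^ k / a"
      using a by (simp add: powr_minus powr_realpow power_one_over field_simps del: of_nat_Suc)
    finally show ?thesis .
  qed
  finally show ?thesis by (simp add: mult_ac)
qed

context
  fixes a \<upsilon> :: real and b :: complex
  assumes a: "a > 0" and \<upsilon>: "\<upsilon> \<ge> 0"
begin

definition Upsilon_term :: "nat \<Rightarrow> real \<Rightarrow> complex" where
  "Upsilon_term k x =
     b ^ (2 * k + 1) / (2 * fact (2 * k + 1)) * (of_real (a powr (- real k + \<upsilon> / 2 - 1))
            * upper_Gamma (of_real (real k - \<upsilon> / 2 + 1)) (of_real (a * x\<^sup>2)))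
   - b ^ (2 * k) / (2 * fact (2 * k)) * (of_real (a powr (- real k + \<upsilon> / 2 - 1 / 2))
            * upper_Gamma (of_real (real k - \<upsilon> / 2 + 1 / 2)) (of_real (a * x\<^sup>2)))"

lemma Upsilon_eq_suminf: "Upsilon \<upsilon> a b x = (\<Sum>k. Upsilon_term k x)"
  unfolding Upsilon_def Upsilon_term_def by (simp only: times_divide_eq_left times_divide_eq_right mult.assoc)

text \<open>Each half is summable by itself. As \<upsilon> >= 0, both orders satisfy s - 1 <= k, so
  the previous bound applies.\<close>

lemma summable_Upsilon_term:
  assumes x: "x > 0"
  shows "summable (\<lambda>k. Upsilon_term k x)"
proof -
  define h where "h = (\<lambda>k. fact k * (norm b ^ 2 / a) ^ k / fact (2 * k))"
  have h: "summable h"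
    unfolding h_def by (rule summable_fact_mult_power_div_fact)
  have "summable (\<lambda>k. b ^ (2 * k + 1) / (2 * fact (2 * k + 1)) * (of_real (a powr (- (real k - \<upsilon> / 2 + 1)))
      * upper_Gamma (of_real (real k - \<upsilon> / 2 + 1)) (of_real (a * x\<^sup>2))))"
  proof (rule summable_comparison_test'[OF summable_mult[OF h, of "norm b * x powr (- \<upsilon>) / a"]])
    fix k :: nat
    have "norm (b ^ (2 * k + 1) / (2 * fact (2 * k + 1)) * (of_real (a powr (- (real k - \<upsilon> / 2 + 1)))
        * upper_Gamma (of_real (real k - \<upsilon> / 2 + 1)) (of_real (a * x\<^sup>2))))
      \<le> norm b ^ (2 * k + 1) / fact (2 * k) * (x powr (2 * (real k - \<upsilon> / 2 + 1 - 1 - k)) / a * ((1 / a) ^ k * fact k))"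
      unfolding norm_mult[of "_ / _"]
    proof (rule mult_mono)
      \<comment> \<open>Weakening the odd factorial to (2k)! lets both halves share the majorant
        \<open>h\<close>.\<close>
      have "(fact (2 * k) :: real) \<le> 2 * fact (2 * k + 1)"
        using fact_mono[of "2 * k" "2 * k + 1", where ?'a = real] fact_ge_zero[of "2 * k + 1", where ?'a = real] by linarith
      then show "norm (b ^ (2 * k + 1) / (2 * fact (2 * k + 1))) \<le> norm b ^ (2 * k + 1) / fact (2 * k)"
        by (simp add: norm_divide norm_mult norm_power divide_left_mono del: fact_Suc)
    qed (use norm_scaled_upper_Gamma_le[OF a x, of "real k - \<upsilon> / 2 + 1" k] \<upsilon> in auto)
    also have "\<dots> = norm b * x powr (- \<upsilon>) / a * h k"
      by (simp add: h_def power_mult power_divide) (simp add: mult_ac)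
    finally show "norm (b ^ (2 * k + 1) / (2 * fact (2 * k + 1)) * (of_real (a powr (- (real k - \<upsilon> / 2 + 1)))
        * upper_Gamma (of_real (real k - \<upsilon> / 2 + 1)) (of_real (a * x\<^sup>2)))) \<le> norm b * x powr (- \<upsilon>) / a * h k" .
  qed
  moreover have "summable (\<lambda>k. b ^ (2 * k) / (2 * fact (2 * k)) * (of_real (a powr (- (real k - \<upsilon> / 2 + 1 / 2)))
      * upper_Gamma (of_real (real k - \<upsilon> / 2 + 1 / 2)) (of_real (a * x\<^sup>2))))"
  proof (rule summable_comparison_test'[OF summable_mult[OF h, of "x powr (- \<upsilon> - 1) / a"]])
    fix k :: nat
    have "norm (b ^ (2 * k) / (2 * fact (2 * k)) * (of_real (a powr (- (real k - \<upsilon> / 2 + 1 / 2)))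
        * upper_Gamma (of_real (real k - \<upsilon> / 2 + 1 / 2)) (of_real (a * x\<^sup>2))))
      \<le> norm b ^ (2 * k) / fact (2 * k) * (x powr (2 * (real k - \<upsilon> / 2 + 1 / 2 - 1 - k)) / a * ((1 / a) ^ k * fact k))"
      unfolding norm_mult[of "_ / _"]
    proof (rule mult_mono)
      show "norm (b ^ (2 * k) / (2 * fact (2 * k))) \<le> norm b ^ (2 * k) / fact (2 * k)"
        by (simp add: norm_divide norm_mult norm_power divide_left_mono del: fact_Suc)
    qed (use norm_scaled_upper_Gamma_le[OF a x, of "real k - \<upsilon> / 2 + 1 / 2" k] \<upsilon> in auto)
    also have "\<dots> = x powr (- \<upsilon> - 1) / a * h k"
      by (simp add: h_def power_mult power_divide) (simp add: mult_ac)
    finally show "norm (b ^ (2 * k) / (2 * fact (2 * k)) * (of_real (a powr (- (real k - \<upsilon> / 2 + 1 / 2)))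
        * upper_Gamma (of_real (real k - \<upsilon> / 2 + 1 / 2)) (of_real (a * x\<^sup>2)))) \<le> x powr (- \<upsilon> - 1) / a * h k" .
  qed
  moreover have "- real k + \<upsilon> / 2 - 1 = - (real k - \<upsilon> / 2 + 1)"
    "- real k + \<upsilon> / 2 - 1 / 2 = - (real k - \<upsilon> / 2 + 1 / 2)" for k
    by simp_all
  ultimately show ?thesis
    unfolding Upsilon_term_def by (simp only: summable_diff)
qed

definition Upsilon_term_deriv :: "nat \<Rightarrow> real \<Rightarrow> complex" where
  "Upsilon_term_deriv k x = of_real (x powr (- \<upsilon>) * exp (- a * x\<^sup>2)) *
     ((- (b * of_real x)) ^ (2 * k) / fact (2 * k) + (- (b * of_real x)) ^ (2 * k + 1) / fact (2 * k + 1))"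

lemma has_vector_derivative_Upsilon_term:
  assumes x: "x > 0"
  shows "(Upsilon_term k has_vector_derivative Upsilon_term_deriv k x) (at x)"
proof -
  \<comment> \<open>2 s - 1 equals 2k + 1 - \<upsilon> for the first order and 2k - \<upsilon> for
    the second; the factor -2 of the derivative cancels the 2 in the denominators and fixes the
    signs.\<close>
  have "x powr (2 * (real k - \<upsilon> / 2 + 1) - 1) = x powr (- \<upsilon>) * x ^ (2 * k + 1)"
    using x powr_add[of x "- \<upsilon>" "real (2 * k + 1)"] by (simp only: powr_realpow) (simp add: algebra_simps)
  moreover have "x powr (2 * (real k - \<upsilon> / 2 + 1 / 2) - 1) = x powr (- \<upsilon>) * x ^ (2 * k)"
    using x by (simp add: algebra_simps flip: powr_realpow powr_add)
  ultimately have eq: "Upsilon_term_deriv k x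
    = b ^ (2 * k + 1) / (2 * fact (2 * k + 1)) * of_real (- 2 * x powr (2 * (real k - \<upsilon> / 2 + 1) - 1) * exp (- a * x\<^sup>2))
    - b ^ (2 * k) / (2 * fact (2 * k)) * of_real (- 2 * x powr (2 * (real k - \<upsilon> / 2 + 1 / 2) - 1) * exp (- a * x\<^sup>2))"
    by (simp add: Upsilon_term_deriv_def power_mult_distrib algebra_simps del: fact_Suc)
  show ?thesis
    unfolding Upsilon_term_def eq
    by (intro has_vector_derivative_diff has_vector_derivative_mult_right
        has_vector_derivative_scaled_upper_Gamma a x) auto
qed

lemma sums_exp_pairs:
  fixes z :: "'a::{banach,real_normed_field}"
  shows "(\<lambda>k. z ^ (2 * k) / fact (2 * k) + z ^ (2 * k + 1) / fact (2 * k + 1)) sums exp z"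
proof -
  have "(\<lambda>n. z ^ n / fact n) sums exp z"
    using exp_converges[of z] by (simp add: scaleR_conv_of_real divide_inverse mult.commute)
  moreover have "sum f {k * 2..<k * 2 + 2} = f (2 * k) + f (2 * k + 1)" for f :: "nat \<Rightarrow> 'a" and k
    by (simp add: mult.commute[of k] numeral_2_eq_2)
  ultimately show ?thesis
    using sums_group[of "\<lambda>n. z ^ n / fact n" "exp z" 2] by (simp only: zero_less_numeral)
qed

lemma has_vector_derivative_Upsilon:
  assumes x: "x > 0"
  shows "(Upsilon \<upsilon> a b has_vector_derivative gauss_exp a b x / of_real (x powr \<upsilon>)) (at x)"
proof -
  \<comment> \<open>On this neighbourhood |b y| <= R and, as \<upsilon> >= 0, y^(- \<upsilon>) <=
    (x/2)^(- \<upsilon>). Together with exp (- a y^2) <= 1 this gives the Weierstrass majorant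
    \<open>M\<close>.\<close>
  define S where "S = {x / 2<..<2 * x}"
  define D where "D = (\<lambda>y. gauss_exp a b y / of_real (y powr \<upsilon>))"
  define R where "R = norm b * (2 * x)"
  define M where "M = (\<lambda>k. (x / 2) powr (- \<upsilon>) * (R ^ (2 * k) / fact (2 * k) + R ^ (2 * k + 1) / fact (2 * k + 1)))"
  have "summable M"
    unfolding M_def using sums_exp_pairs[of R] by (intro summable_mult) (rule sums_summable)
  have D_sums: "(\<lambda>k. Upsilon_term_deriv k y) sums D y" if "y \<in> S" for y
  proof -
    have "(\<lambda>k. Upsilon_term_deriv k y) sums (of_real (y powr (- \<upsilon>) * exp (- a * y\<^sup>2)) * exp (- (b * of_real y)))"
      unfolding Upsilon_term_deriv_def by (intro sums_mult sums_exp_pairs)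
    also have "of_real (y powr (- \<upsilon>) * exp (- a * y\<^sup>2)) * exp (- (b * of_real y)) = D y"
      unfolding D_def gauss_exp_split powr_minus of_real_mult of_real_inverse by (simp add: field_simps)
    finally show ?thesis .
  qed
  have bound: "norm (Upsilon_term_deriv k y) \<le> M k" if y: "y \<in> S" for k y
  proof -
    have le: "norm (b * of_real y) \<le> R"
      unfolding R_def norm_mult using y by (intro mult_left_mono) (auto simp: S_def)
    have pow: "norm ((- (b * of_real y)) ^ n / fact n) \<le> R ^ n / fact n" for n
      unfolding norm_divide norm_power norm_minus_cancel norm_fact using le
      by (intro divide_right_mono power_mono) auto
    have "norm (of_real (y powr (- \<upsilon>) * exp (- a * y\<^sup>2)) :: complex) \<le> (x / 2) powr (- \<upsilon>) * 1"
      unfolding norm_of_real abs_mult using y x a \<upsilon>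
      by (intro mult_mono) (auto simp: S_def intro!: powr_mono2')
    then show ?thesis
      unfolding Upsilon_term_deriv_def M_def norm_mult
      by (intro mult_mono norm_triangle_le add_mono pow) auto
  qed
  have "uniform_limit S (\<lambda>n y. \<Sum>i<n. Upsilon_term_deriv i y) (\<lambda>y. \<Sum>i. Upsilon_term_deriv i y) sequentially"
    using bound \<open>summable M\<close> by (rule Weierstrass_m_test)
  then have unif: "uniform_limit S (\<lambda>n y. \<Sum>i<n. Upsilon_term_deriv i y) D sequentially"
    by (rule uniform_limit_cong'[THEN iffD1, rotated -1]) (use D_sums in \<open>auto simp: sums_iff\<close>)
  \<comment> \<open>Uniform convergence of the derivatives plus convergence at the single point x
    suffices for termwise differentiation on the convex set \<open>S\<close>.\<close>
  have "\<exists>g. \<forall>y\<in>S. (\<lambda>k. Upsilon_term k y) sums g y \<and> (g has_derivative (\<lambda>h. h *\<^sub>R D y)) (at y within S)"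
  proof (rule has_derivative_series)
    show "convex S" "x \<in> S" using x by (auto simp: S_def)
    show "(\<lambda>k. Upsilon_term k x) sums (\<Sum>k. Upsilon_term k x)"
      using summable_Upsilon_term[OF x] by (rule summable_sums)
    show "(Upsilon_term k has_derivative (\<lambda>h. h *\<^sub>R Upsilon_term_deriv k y)) (at y within S)" if "y \<in> S" for k y
      using has_vector_derivative_at_within[OF has_vector_derivative_Upsilon_term] that x
      by (auto simp: S_def has_vector_derivative_def)
    fix e :: real assume "e > 0"
    from uniform_limitD[OF unif this]
    show "\<forall>\<^sub>F n in sequentially. \<forall>y\<in>S. \<forall>h. norm ((\<Sum>i<n. h *\<^sub>R Upsilon_term_deriv i y) - h *\<^sub>R D y) \<le> e * norm h"
    proof eventually_elim
      case (elim n)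
      have "norm ((\<Sum>i<n. h *\<^sub>R Upsilon_term_deriv i y) - h *\<^sub>R D y) = norm h * dist (\<Sum>i<n. Upsilon_term_deriv i y) (D y)" for y h
        by (simp add: dist_norm flip: scaleR_sum_right scaleR_diff_right)
      with elim show ?case
        by (metis less_imp_le mult.commute mult_right_mono norm_ge_zero)
    qed
  qed
  then obtain g where g: "\<And>y. y \<in> S \<Longrightarrow> (\<lambda>k. Upsilon_term k y) sums g y"
    "\<And>y. y \<in> S \<Longrightarrow> (g has_vector_derivative D y) (at y within S)"
    unfolding has_vector_derivative_def by blast
  have S: "open S" "x \<in> S" using x by (auto simp: S_def)
  have "(g has_vector_derivative D x) (at x)"
    using g(2)[OF S(2)] unfolding at_within_open[OF S(2,1)] .
  then have "(Upsilon \<upsilon> a b has_vector_derivative D x) (at x)"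
  proof (rule has_vector_derivative_transform_within_open[OF _ S])
    fix y assume "y \<in> S"
    then show "g y = Upsilon \<upsilon> a b y"
      unfolding Upsilon_eq_suminf by (rule sums_unique[OF g(1)])
  qed
  then show ?thesis by (simp add: D_def)
qed

end

lemma has_vector_derivative_Upsilon_of_nat:
  assumes "a > 0" "x > 0"
  shows "(Upsilon (of_nat n) a b has_vector_derivative gauss_exp a b x / of_real x ^ n) (at x)"
  using has_vector_derivative_Upsilon[of a "of_nat n" x b] assms by (simp add: powr_realpow)

lemma has_vector_derivative_Upsilon_numeral:
  assumes "a > 0" "x > 0"
  shows "(Upsilon 1 a b has_vector_derivative gauss_exp a b x / of_real x) (at x)"
    and "(Upsilon (numeral n) a b has_vector_derivative gauss_exp a b x / of_real x ^ numeral n) (at x)"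
  using has_vector_derivative_Upsilon_of_nat[OF assms, of 1 b]
    has_vector_derivative_Upsilon_of_nat[OF assms, of "numeral n" b] by simp_all


section \<open>The error function and the closed forms V(0,0), V(1,1)\<close>

lemma erf_has_field_derivative:
  "(erf has_field_derivative of_real (2 / sqrt pi) * exp (- z\<^sup>2)) (at z)"
proof -
  \<comment> \<open>An entire integrand has a primitive on the whole plane; the segment integral is
    then a difference of its values.\<close>
  obtain g :: "complex \<Rightarrow> complex" where g: "\<And>z. (g has_field_derivative exp (- z\<^sup>2)) (at z)"
  proof -
    have "(\<lambda>z::complex. exp (- z\<^sup>2)) holomorphic_on UNIV"
      by (intro holomorphic_intros)
    then show ?thesis
      using that by (rule holomorphic_convex_primitive'[OF convex_UNIV open_UNIV]) simp
  qed
  have "contour_integral (linepath 0 z) (\<lambda>t. exp (- t\<^sup>2)) = g z - g 0" for z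
    using contour_integral_primitive[of UNIV g "\<lambda>z. exp (- z\<^sup>2)" "linepath 0 z"] g
    by (intro contour_integral_unique) simp
  then have "erf = (\<lambda>z. of_real (2 / sqrt pi) * (g z - g 0))"
    by (simp add: erf_def fun_eq_iff)
  then show ?thesis
    using DERIV_cmult[OF DERIV_diff[OF g[of z] DERIV_const[of "g 0"]], of "of_real (2 / sqrt pi)"] by simp
qed

lemma has_vector_derivative_gauss_exp:
  "(gauss_exp a b has_vector_derivative - (2 * of_real a * of_real x + b) * gauss_exp a b x) (at x)"
proof -
  have "((\<lambda>x. exp (- of_real a * x\<^sup>2 - b * x)) has_field_derivative
      - (2 * of_real a * of_real x + b) * exp (- of_real a * (of_real x)\<^sup>2 - b * of_real x)) (at (of_real x))"
    by (auto intro!: derivative_eq_intros simp: algebra_simps)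
  from has_vector_derivative_real_field[OF this] show ?thesis
    unfolding gauss_exp_def by simp
qed

lemma has_vector_derivative_W:
  assumes a: "a > 0"
  shows "(W a b has_vector_derivative 2 * of_real (sqrt a) * gauss_exp a b x) (at x)"
proof -
  define r where "r = complex_of_real (sqrt a)"
  have r: "r ^ 2 = of_real a" "r \<noteq> 0"
    using a by (simp_all add: r_def flip: of_real_power)
  define t where "t = (\<lambda>x. (2 * of_real a * x + b) / (2 * r))"
  have "(t has_field_derivative r) (at (of_real x))"
    unfolding t_def using r by (auto intro!: derivative_eq_intros simp: field_simps power2_eq_square)
  from DERIV_chain2[OF erf_has_field_derivative this]
  have "((\<lambda>x. of_real (sqrt pi) * exp (b\<^sup>2 / (4 * of_real a)) * erf (t x)) has_field_derivative
      of_real (sqrt pi) * exp (b\<^sup>2 / (4 * of_real a)) * (of_real (2 / sqrt pi) * exp (- (t (of_real x))\<^sup>2) * r)) (at (of_real x))"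
    by (rule DERIV_cmult)
  also have "of_real (sqrt pi) * exp (b\<^sup>2 / (4 * of_real a)) * (of_real (2 / sqrt pi) * exp (- (t (of_real x))\<^sup>2) * r)
      = 2 * r * (exp (b\<^sup>2 / (4 * of_real a)) * exp (- (t (of_real x))\<^sup>2))"
    by simp
  also have "exp (b\<^sup>2 / (4 * of_real a)) * exp (- (t (of_real x))\<^sup>2) = gauss_exp a b x"
  proof -
    \<comment> \<open>Completing the square explains the factor exp (b^2 / (4a)) in
      \<open>W\<close>.\<close>
    have "b\<^sup>2 / (4 * of_real a) - (t (of_real x))\<^sup>2 = - of_real (a * x\<^sup>2) - b * of_real x"
      unfolding t_def r(1)[symmetric] of_real_mult of_real_power using r(2)
      by (simp add: field_simps power2_eq_square)
    then show ?thesis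
      by (simp add: gauss_exp_def flip: exp_add)
  qed
  finally show ?thesis
    unfolding W_def t_def r_def[symmetric] by (rule has_vector_derivative_real_field)
qed

lemma has_vector_derivative_V00:
  assumes "a > 0"
  shows "(V00 a b has_vector_derivative gauss_exp a b x) (at x)"
  unfolding V00_def
  by (rule has_vector_derivative_eq_rhs[OF has_vector_derivative_divide[OF has_vector_derivative_W[OF assms]]])
     (use assms in simp)

text \<open>The \<open>W\<close> part contributes 1 - b^2 / (2a) and the exponential part b x + b^2
  / (2a), both times E; the quadratic terms in b cancel.\<close>

lemma has_vector_derivative_V11:
  assumes "a > 0"
  shows "(V11 a b has_vector_derivative (1 + b * of_real x) * gauss_exp a b x) (at x)"
proof -
  have r: "a powr (3 / 2) = a * sqrt a"
    using assms powr_add[of a 1 "1 / 2"] by (simp add: powr_half_sqrt)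
  show ?thesis
    unfolding V11_def r
    by (rule has_vector_derivative_eq_rhs[OF has_vector_derivative_diff[OF
        has_vector_derivative_divide[OF has_vector_derivative_mult_right[OF has_vector_derivative_W[OF assms]]]
        has_vector_derivative_divide[OF has_vector_derivative_mult_right[OF has_vector_derivative_gauss_exp]]]])
      (use assms in \<open>simp add: field_simps power2_eq_square\<close>)
qed

section \<open>Sets of antiderivatives on the positive half-line, and the integral formulas\<close>

lemma antiderivatives_cong:
  assumes "\<And>x. x > 0 \<Longrightarrow> f x = g x"
  shows "antiderivatives f = antiderivatives g"
  using assms by (simp add: antiderivatives_def)

text \<open>The half-line is convex, so a difference of two antiderivatives, having derivative zero,
  is constant there. Conversely, the half-line is open, so agreement with F + c on it already
  determines the derivative.\<close>

lemma antiderivatives_eq_plus_const: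
  assumes F: "\<And>x. x > 0 \<Longrightarrow> (F has_vector_derivative f x) (at x)"
  shows "antiderivatives f = plus_const F"
proof (intro equalityI subsetI)
  fix G assume "G \<in> antiderivatives f"
  then have "((\<lambda>x. G x - F x) has_vector_derivative 0) (at x within {0<..})" if "x > 0" for x
    using has_vector_derivative_diff[OF _ F[OF that], of G "f x"] that
    by (auto simp: antiderivatives_def intro: has_vector_derivative_at_within)
  then obtain c where "\<And>x. x \<in> {0<..} \<Longrightarrow> G x - F x = c"
    using has_vector_derivative_zero_constant[of "{0::real<..}" "\<lambda>x. G x - F x"] by auto
  then have "G x = F x + c" if "x > 0" for x
    using that by (metis add.commute diff_add_cancel greaterThan_iff)
  then show "G \<in> plus_const F"
    by (auto simp: plus_const_def)
next
  fix G assume "G \<in> plus_const F"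
  then obtain c where c: "\<And>x. x > 0 \<Longrightarrow> G x = F x + c"
    by (auto simp: plus_const_def)
  have "(G has_vector_derivative f x) (at x)" if "x > 0" for x
  proof (rule has_vector_derivative_transform_within_open[of _ _ _ "{0<..}"])
    show "((\<lambda>x. F x + c) has_vector_derivative f x) (at x)"
      using F[OF that] by (auto intro!: derivative_eq_intros)
  qed (use that c in auto)
  then show "G \<in> antiderivatives f"
    by (simp add: antiderivatives_def)
qed

text \<open>The condition \<open>b \<noteq> 0\<close> is explicit since every chain but the first
  divides by b or by the root. In the last chain the final member differs from the English text:
  integrating the preceding integrand term by term gives the coefficients 30, 120, 360 = 120 + 240,
  720, 720, 5 and 1, whereas the printed ones lack, for instance, the contribution of 720 E / (b^4
  x^5).\<close>

theorem mainTheorem8: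
  fixes a :: real and b :: complex
  assumes "a > 0" and "b \<noteq> 0"
  shows "
     (antiderivatives (\<lambda>x. exp (- a * x^2) * upper_Gamma 1 (b * x) / x)
       = antiderivatives (\<lambda>x. gauss_exp a b x / x)
     \<and> antiderivatives (\<lambda>x. gauss_exp a b x / x)
       = plus_const (\<lambda>x. Upsilon 1 a b x))
   \<and> (antiderivatives (\<lambda>x. exp (- a * x^2) * upper_Gamma 2 (b * x) / x)
       = antiderivatives (\<lambda>x. b * (kappa a b 0 x / root_bx b x + root_bx b x * kappa a b 0 x))
     \<and> antiderivatives (\<lambda>x. b * (kappa a b 0 x / root_bx b x + root_bx b x * kappa a b 0 x))
       = antiderivatives (\<lambda>x. gauss_exp a b x / x + b * gauss_exp a b x)
     \<and> antiderivatives (\<lambda>x. gauss_exp a b x / x + b * gauss_exp a b x)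
       = plus_const (\<lambda>x. Upsilon 1 a b x + b * V00 a b x))
   \<and> (antiderivatives (\<lambda>x. exp (- a * x^2) * upper_Gamma 3 (b * x) / x)
       = antiderivatives (\<lambda>x. b * (2 * kappa a b 0 x / root_bx b x + root_bx b x ^ 3 * kappa a b 1 x
          + 2 * (1 - 1 / 2) * root_bx b x * kappa a b 0 x))
     \<and> antiderivatives (\<lambda>x. b * (2 * kappa a b 0 x / root_bx b x + root_bx b x ^ 3 * kappa a b 1 x
          + 2 * (1 - 1 / 2) * root_bx b x * kappa a b 0 x))
       = antiderivatives (\<lambda>x. b * (2 * gauss_exp a b x / (b * x) + gauss_exp a b x
          + b * x * (1 / (b * x) + 1) * gauss_exp a b x))
     \<and> antiderivatives (\<lambda>x. b * (2 * gauss_exp a b x / (b * x) + gauss_exp a b x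
          + b * x * (1 / (b * x) + 1) * gauss_exp a b x))
       = plus_const (\<lambda>x. 2 * Upsilon 1 a b x + b * V00 a b x + b * V11 a b x))
   \<and> (antiderivatives (\<lambda>x. exp (- a * x^2) * upper_Gamma 3 (b * x) / (b^2 * x^3))
       = antiderivatives (\<lambda>x. b * kappa a b 0 x / root_bx b x + 2 * b * kappa a b 1 x / root_bx b x ^ 3)
     \<and> antiderivatives (\<lambda>x. b * kappa a b 0 x / root_bx b x + 2 * b * kappa a b 1 x / root_bx b x ^ 3)
       = antiderivatives (\<lambda>x. gauss_exp a b x / x + 2 * (1 + 1 / (b * x)) * gauss_exp a b x / (b * x^2))
     \<and> antiderivatives (\<lambda>x. gauss_exp a b x / x + 2 * (1 + 1 / (b * x)) * gauss_exp a b x / (b * x^2))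
       = plus_const (\<lambda>x. Upsilon 1 a b x + 2 / b * Upsilon 2 a b x + 2 / b^2 * Upsilon 3 a b x))
   \<and> (antiderivatives (\<lambda>x. exp (- a * x^2) * upper_Gamma 4 (b * x) / (b^2 * x^3))
       = antiderivatives (\<lambda>x. 3 * b * kappa a b 0 x / root_bx b x + 6 * b * kappa a b 1 x / root_bx b x ^ 3
          + b * root_bx b x * kappa a b 0 x)
     \<and> antiderivatives (\<lambda>x. 3 * b * kappa a b 0 x / root_bx b x + 6 * b * kappa a b 1 x / root_bx b x ^ 3
          + b * root_bx b x * kappa a b 0 x)
       = antiderivatives (\<lambda>x. 3 * gauss_exp a b x / x + 6 * (1 + 1 / (b * x)) * gauss_exp a b x / (b * x^2)
          + b * gauss_exp a b x)
     \<and> antiderivatives (\<lambda>x. 3 * gauss_exp a b x / x + 6 * (1 + 1 / (b * x)) * gauss_exp a b x / (b * x^2)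
          + b * gauss_exp a b x)
       = plus_const (\<lambda>x. 3 * Upsilon 1 a b x + 6 / b * Upsilon 2 a b x + 6 / b^2 * Upsilon 3 a b x
          + b * V00 a b x))
   \<and> (antiderivatives (\<lambda>x. exp (- a * x^2) * upper_Gamma 5 (b * x) / (b^2 * x^3))
       = antiderivatives (\<lambda>x. 12 * b * kappa a b 0 x / root_bx b x + 24 * b * kappa a b 1 x / root_bx b x ^ 3
          + 3 * b * root_bx b x * kappa a b 0 x + b * root_bx b x ^ 3 * kappa a b 1 x)
     \<and> antiderivatives (\<lambda>x. 12 * b * kappa a b 0 x / root_bx b x + 24 * b * kappa a b 1 x / root_bx b x ^ 3
          + 3 * b * root_bx b x * kappa a b 0 x + b * root_bx b x ^ 3 * kappa a b 1 x)
       = antiderivatives (\<lambda>x. 12 * gauss_exp a b x / x + 24 * (1 / (b * x) + 1) * gauss_exp a b x / (b * x^2)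
          + 3 * b * gauss_exp a b x + b^2 * x * (1 / (b * x) + 1) * gauss_exp a b x)
     \<and> antiderivatives (\<lambda>x. 12 * gauss_exp a b x / x + 24 * (1 / (b * x) + 1) * gauss_exp a b x / (b * x^2)
          + 3 * b * gauss_exp a b x + b^2 * x * (1 / (b * x) + 1) * gauss_exp a b x)
       = plus_const (\<lambda>x. 12 * Upsilon 1 a b x + 24 / b * Upsilon 2 a b x
          + 24 / b^2 * Upsilon 3 a b x + 3 * b * V00 a b x
          + b * V11 a b x))
   \<and> (antiderivatives (\<lambda>x. exp (- a * x^2) * upper_Gamma 5 (b * x) / (b^4 * x^5))
       = antiderivatives (\<lambda>x. b * kappa a b 0 x / root_bx b x + 4 * b * kappa a b 1 x / root_bx b x ^ 3
          + 8 * b * kappa a b 2 x / root_bx b x ^ 5)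
     \<and> antiderivatives (\<lambda>x. b * kappa a b 0 x / root_bx b x + 4 * b * kappa a b 1 x / root_bx b x ^ 3
          + 8 * b * kappa a b 2 x / root_bx b x ^ 5)
       = antiderivatives (\<lambda>x. gauss_exp a b x / x + 4 * (1 + 1 / (b * x)) * gauss_exp a b x / (b * x^2)
          + 8 * (1 + 3 / (b * x) + 3 / (b^2 * x^2)) * gauss_exp a b x / (b^2 * x^3))
     \<and> antiderivatives (\<lambda>x. gauss_exp a b x / x + 4 * (1 + 1 / (b * x)) * gauss_exp a b x / (b * x^2)
          + 8 * (1 + 3 / (b * x) + 3 / (b^2 * x^2)) * gauss_exp a b x / (b^2 * x^3))
       = plus_const (\<lambda>x. Upsilon 1 a b x + 4 / b * Upsilon 2 a b x + (4 + 8) / b^2 * Upsilon 3 a b x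
          + 24 / b^3 * Upsilon 4 a b x + 24 / b^4 * Upsilon 5 a b x))
   \<and> (antiderivatives (\<lambda>x. exp (- a * x^2) * upper_Gamma 6 (b * x) / (b^4 * x^5))
       = antiderivatives (\<lambda>x. 5 * b * kappa a b 0 x / root_bx b x + 20 * b * kappa a b 1 x / root_bx b x ^ 3
          + 40 * b * kappa a b 2 x / root_bx b x ^ 5 + b * root_bx b x * kappa a b 0 x)
     \<and> antiderivatives (\<lambda>x. 5 * b * kappa a b 0 x / root_bx b x + 20 * b * kappa a b 1 x / root_bx b x ^ 3
          + 40 * b * kappa a b 2 x / root_bx b x ^ 5 + b * root_bx b x * kappa a b 0 x)
       = antiderivatives (\<lambda>x. 5 * gauss_exp a b x / x + 20 * (1 / (b * x) + 1) * gauss_exp a b x / (b * x^2)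
          + 40 * (3 / (b^2 * x^2) + 3 / (b * x) + 1) * gauss_exp a b x / (b^2 * x^3)
          + b * gauss_exp a b x)
     \<and> antiderivatives (\<lambda>x. 5 * gauss_exp a b x / x + 20 * (1 / (b * x) + 1) * gauss_exp a b x / (b * x^2)
          + 40 * (3 / (b^2 * x^2) + 3 / (b * x) + 1) * gauss_exp a b x / (b^2 * x^3)
          + b * gauss_exp a b x)
       = plus_const (\<lambda>x. 5 * Upsilon 1 a b x + 20 / b * Upsilon 2 a b x
          + 60 / b^2 * Upsilon 3 a b x + 120 / b^3 * Upsilon 4 a b x
          + 120 / b^4 * Upsilon 5 a b x + b * V00 a b x))
   \<and> (antiderivatives (\<lambda>x. exp (- a * x^2) * upper_Gamma 7 (b * x) / (b^4 * x^5))
       = antiderivatives (\<lambda>x. 30 * b * kappa a b 0 x / root_bx b x + 120 * b * kappa a b 1 x / root_bx b x ^ 3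
          + 240 * b * kappa a b 2 x / root_bx b x ^ 5 + 5 * b * root_bx b x * kappa a b 0 x
          + b * root_bx b x ^ 3 * kappa a b 1 x)
     \<and> antiderivatives (\<lambda>x. 30 * b * kappa a b 0 x / root_bx b x + 120 * b * kappa a b 1 x / root_bx b x ^ 3
          + 240 * b * kappa a b 2 x / root_bx b x ^ 5 + 5 * b * root_bx b x * kappa a b 0 x
          + b * root_bx b x ^ 3 * kappa a b 1 x)
       = antiderivatives (\<lambda>x. 30 * gauss_exp a b x / x + 120 * (1 / (b * x) + 1) * gauss_exp a b x / (b * x^2)
          + 240 * (3 / (b^2 * x^2) + 3 / (b * x) + 1) * gauss_exp a b x / (b^2 * x^3)
          + 5 * b * gauss_exp a b x + b^2 * x * (1 / (b * x) + 1) * gauss_exp a b x)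
     \<and> antiderivatives (\<lambda>x. 30 * gauss_exp a b x / x + 120 * (1 / (b * x) + 1) * gauss_exp a b x / (b * x^2)
          + 240 * (3 / (b^2 * x^2) + 3 / (b * x) + 1) * gauss_exp a b x / (b^2 * x^3)
          + 5 * b * gauss_exp a b x + b^2 * x * (1 / (b * x) + 1) * gauss_exp a b x)
       = plus_const (\<lambda>x. 30 * Upsilon 1 a b x + 120 / b * Upsilon 2 a b x
          + 360 / b^2 * Upsilon 3 a b x + 720 / b^3 * Upsilon 4 a b x
          + 720 / b^4 * Upsilon 5 a b x + 5 * b * V00 a b x
          + b * V11 a b x))"
proof (intro conjI)
  note UG = exp_times_upper_Gamma_numeral
  note K = kappa_root_products[OF _ assms(2)]
  show "antiderivatives (\<lambda>x. exp (- a * x^2) * upper_Gamma 1 (b * x) / x)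
       = antiderivatives (\<lambda>x. gauss_exp a b x / x)"
    by (rule antiderivatives_cong, simp only: UG)
  show "antiderivatives (\<lambda>x. gauss_exp a b x / x)
       = plus_const (\<lambda>x. Upsilon 1 a b x)"
    \<comment> \<open>The derivative of the right-hand side is assembled summand by summand into an
      unknown, and only then compared with the integrand as a rational function times E.\<close>
    by (intro antiderivatives_eq_plus_const, rule has_vector_derivative_eq_rhs,
        (rule has_vector_derivative_add has_vector_derivative_mult_right
          has_vector_derivative_Upsilon_numeral has_vector_derivative_V00 has_vector_derivative_V11
          assms | assumption)+)
      (use assms in \<open>simp_all add: field_simps eval_nat_numeral\<close>)
  show "antiderivatives (\<lambda>x. exp (- a * x^2) * upper_Gamma 2 (b * x) / x)
       = antiderivatives (\<lambda>x. b * (kappa a b 0 x / root_bx b x + root_bx b x * kappa a b 0 x))"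
    \<comment> \<open>After rewriting, both sides are Laurent polynomials in x times E; what remains
      is clearing denominators.\<close>
    by (rule antiderivatives_cong, simp only: UG K)
      (use assms in \<open>simp add: field_simps eval_nat_numeral\<close>)
  show "antiderivatives (\<lambda>x. b * (kappa a b 0 x / root_bx b x + root_bx b x * kappa a b 0 x))
       = antiderivatives (\<lambda>x. gauss_exp a b x / x + b * gauss_exp a b x)"
    by (rule antiderivatives_cong, simp only: UG K)
      (use assms in \<open>simp add: field_simps eval_nat_numeral\<close>)
  show "antiderivatives (\<lambda>x. gauss_exp a b x / x + b * gauss_exp a b x)
       = plus_const (\<lambda>x. Upsilon 1 a b x + b * V00 a b x)"
    by (intro antiderivatives_eq_plus_const, rule has_vector_derivative_eq_rhs,
        (rule has_vector_derivative_add has_vector_derivative_mult_right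
          has_vector_derivative_Upsilon_numeral has_vector_derivative_V00 has_vector_derivative_V11
          assms | assumption)+)
      (use assms in \<open>simp_all add: field_simps eval_nat_numeral\<close>)
  show "antiderivatives (\<lambda>x. exp (- a * x^2) * upper_Gamma 3 (b * x) / x)
       = antiderivatives (\<lambda>x. b * (2 * kappa a b 0 x / root_bx b x + root_bx b x ^ 3 * kappa a b 1 x
          + 2 * (1 - 1 / 2) * root_bx b x * kappa a b 0 x))"
    by (rule antiderivatives_cong, simp only: UG K)
      (use assms in \<open>simp add: field_simps eval_nat_numeral\<close>)
  show "antiderivatives (\<lambda>x. b * (2 * kappa a b 0 x / root_bx b x + root_bx b x ^ 3 * kappa a b 1 x
          + 2 * (1 - 1 / 2) * root_bx b x * kappa a b 0 x))
       = antiderivatives (\<lambda>x. b * (2 * gauss_exp a b x / (b * x) + gauss_exp a b x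
          + b * x * (1 / (b * x) + 1) * gauss_exp a b x))"
    by (rule antiderivatives_cong, simp only: UG K)
      (use assms in \<open>simp add: field_simps eval_nat_numeral\<close>)
  show "antiderivatives (\<lambda>x. b * (2 * gauss_exp a b x / (b * x) + gauss_exp a b x
          + b * x * (1 / (b * x) + 1) * gauss_exp a b x))
       = plus_const (\<lambda>x. 2 * Upsilon 1 a b x + b * V00 a b x + b * V11 a b x)"
    by (intro antiderivatives_eq_plus_const, rule has_vector_derivative_eq_rhs,
        (rule has_vector_derivative_add has_vector_derivative_mult_right
          has_vector_derivative_Upsilon_numeral has_vector_derivative_V00 has_vector_derivative_V11
          assms | assumption)+)
      (use assms in \<open>simp_all add: field_simps eval_nat_numeral\<close>)
  show "antiderivatives (\<lambda>x. exp (- a * x^2) * upper_Gamma 3 (b * x) / (b^2 * x^3))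
       = antiderivatives (\<lambda>x. b * kappa a b 0 x / root_bx b x + 2 * b * kappa a b 1 x / root_bx b x ^ 3)"
    by (rule antiderivatives_cong, simp only: UG K)
      (use assms in \<open>simp add: field_simps eval_nat_numeral\<close>)
  show "antiderivatives (\<lambda>x. b * kappa a b 0 x / root_bx b x + 2 * b * kappa a b 1 x / root_bx b x ^ 3)
       = antiderivatives (\<lambda>x. gauss_exp a b x / x + 2 * (1 + 1 / (b * x)) * gauss_exp a b x / (b * x^2))"
    by (rule antiderivatives_cong, simp only: UG K)
      (use assms in \<open>simp add: field_simps eval_nat_numeral\<close>)
  show "antiderivatives (\<lambda>x. gauss_exp a b x / x + 2 * (1 + 1 / (b * x)) * gauss_exp a b x / (b * x^2))
       = plus_const (\<lambda>x. Upsilon 1 a b x + 2 / b * Upsilon 2 a b x + 2 / b^2 * Upsilon 3 a b x)"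
    by (intro antiderivatives_eq_plus_const, rule has_vector_derivative_eq_rhs,
        (rule has_vector_derivative_add has_vector_derivative_mult_right
          has_vector_derivative_Upsilon_numeral has_vector_derivative_V00 has_vector_derivative_V11
          assms | assumption)+)
      (use assms in \<open>simp_all add: field_simps eval_nat_numeral\<close>)
  show "antiderivatives (\<lambda>x. exp (- a * x^2) * upper_Gamma 4 (b * x) / (b^2 * x^3))
       = antiderivatives (\<lambda>x. 3 * b * kappa a b 0 x / root_bx b x + 6 * b * kappa a b 1 x / root_bx b x ^ 3
          + b * root_bx b x * kappa a b 0 x)"
    by (rule antiderivatives_cong, simp only: UG K)
      (use assms in \<open>simp add: field_simps eval_nat_numeral\<close>)
  show "antiderivatives (\<lambda>x. 3 * b * kappa a b 0 x / root_bx b x + 6 * b * kappa a b 1 x / root_bx b x ^ 3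
          + b * root_bx b x * kappa a b 0 x)
       = antiderivatives (\<lambda>x. 3 * gauss_exp a b x / x + 6 * (1 + 1 / (b * x)) * gauss_exp a b x / (b * x^2)
          + b * gauss_exp a b x)"
    by (rule antiderivatives_cong, simp only: UG K)
      (use assms in \<open>simp add: field_simps eval_nat_numeral\<close>)
  show "antiderivatives (\<lambda>x. 3 * gauss_exp a b x / x + 6 * (1 + 1 / (b * x)) * gauss_exp a b x / (b * x^2)
          + b * gauss_exp a b x)
       = plus_const (\<lambda>x. 3 * Upsilon 1 a b x + 6 / b * Upsilon 2 a b x + 6 / b^2 * Upsilon 3 a b x
          + b * V00 a b x)"
    by (intro antiderivatives_eq_plus_const, rule has_vector_derivative_eq_rhs,
        (rule has_vector_derivative_add has_vector_derivative_mult_right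
          has_vector_derivative_Upsilon_numeral has_vector_derivative_V00 has_vector_derivative_V11
          assms | assumption)+)
      (use assms in \<open>simp_all add: field_simps eval_nat_numeral\<close>)
  show "antiderivatives (\<lambda>x. exp (- a * x^2) * upper_Gamma 5 (b * x) / (b^2 * x^3))
       = antiderivatives (\<lambda>x. 12 * b * kappa a b 0 x / root_bx b x + 24 * b * kappa a b 1 x / root_bx b x ^ 3
          + 3 * b * root_bx b x * kappa a b 0 x + b * root_bx b x ^ 3 * kappa a b 1 x)"
    by (rule antiderivatives_cong, simp only: UG K)
      (use assms in \<open>simp add: field_simps eval_nat_numeral\<close>)
  show "antiderivatives (\<lambda>x. 12 * b * kappa a b 0 x / root_bx b x + 24 * b * kappa a b 1 x / root_bx b x ^ 3
          + 3 * b * root_bx b x * kappa a b 0 x + b * root_bx b x ^ 3 * kappa a b 1 x)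
       = antiderivatives (\<lambda>x. 12 * gauss_exp a b x / x + 24 * (1 / (b * x) + 1) * gauss_exp a b x / (b * x^2)
          + 3 * b * gauss_exp a b x + b^2 * x * (1 / (b * x) + 1) * gauss_exp a b x)"
    by (rule antiderivatives_cong, simp only: UG K)
      (use assms in \<open>simp add: field_simps eval_nat_numeral\<close>)
  show "antiderivatives (\<lambda>x. 12 * gauss_exp a b x / x + 24 * (1 / (b * x) + 1) * gauss_exp a b x / (b * x^2)
          + 3 * b * gauss_exp a b x + b^2 * x * (1 / (b * x) + 1) * gauss_exp a b x)
       = plus_const (\<lambda>x. 12 * Upsilon 1 a b x + 24 / b * Upsilon 2 a b x
          + 24 / b^2 * Upsilon 3 a b x + 3 * b * V00 a b x
          + b * V11 a b x)"
    by (intro antiderivatives_eq_plus_const, rule has_vector_derivative_eq_rhs,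
        (rule has_vector_derivative_add has_vector_derivative_mult_right
          has_vector_derivative_Upsilon_numeral has_vector_derivative_V00 has_vector_derivative_V11
          assms | assumption)+)
      (use assms in \<open>simp_all add: field_simps eval_nat_numeral\<close>)
  show "antiderivatives (\<lambda>x. exp (- a * x^2) * upper_Gamma 5 (b * x) / (b^4 * x^5))
       = antiderivatives (\<lambda>x. b * kappa a b 0 x / root_bx b x + 4 * b * kappa a b 1 x / root_bx b x ^ 3
          + 8 * b * kappa a b 2 x / root_bx b x ^ 5)"
    by (rule antiderivatives_cong, simp only: UG K)
      (use assms in \<open>simp add: field_simps eval_nat_numeral\<close>)
  show "antiderivatives (\<lambda>x. b * kappa a b 0 x / root_bx b x + 4 * b * kappa a b 1 x / root_bx b x ^ 3
          + 8 * b * kappa a b 2 x / root_bx b x ^ 5)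
       = antiderivatives (\<lambda>x. gauss_exp a b x / x + 4 * (1 + 1 / (b * x)) * gauss_exp a b x / (b * x^2)
          + 8 * (1 + 3 / (b * x) + 3 / (b^2 * x^2)) * gauss_exp a b x / (b^2 * x^3))"
    by (rule antiderivatives_cong, simp only: UG K)
      (use assms in \<open>simp add: field_simps eval_nat_numeral\<close>)
  show "antiderivatives (\<lambda>x. gauss_exp a b x / x + 4 * (1 + 1 / (b * x)) * gauss_exp a b x / (b * x^2)
          + 8 * (1 + 3 / (b * x) + 3 / (b^2 * x^2)) * gauss_exp a b x / (b^2 * x^3))
       = plus_const (\<lambda>x. Upsilon 1 a b x + 4 / b * Upsilon 2 a b x + (4 + 8) / b^2 * Upsilon 3 a b x
          + 24 / b^3 * Upsilon 4 a b x + 24 / b^4 * Upsilon 5 a b x)"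
    by (intro antiderivatives_eq_plus_const, rule has_vector_derivative_eq_rhs,
        (rule has_vector_derivative_add has_vector_derivative_mult_right
          has_vector_derivative_Upsilon_numeral has_vector_derivative_V00 has_vector_derivative_V11
          assms | assumption)+)
      (use assms in \<open>simp_all add: field_simps eval_nat_numeral\<close>)
  show "antiderivatives (\<lambda>x. exp (- a * x^2) * upper_Gamma 6 (b * x) / (b^4 * x^5))
       = antiderivatives (\<lambda>x. 5 * b * kappa a b 0 x / root_bx b x + 20 * b * kappa a b 1 x / root_bx b x ^ 3
          + 40 * b * kappa a b 2 x / root_bx b x ^ 5 + b * root_bx b x * kappa a b 0 x)"
    by (rule antiderivatives_cong, simp only: UG K)
      (use assms in \<open>simp add: field_simps eval_nat_numeral\<close>)
  show "antiderivatives (\<lambda>x. 5 * b * kappa a b 0 x / root_bx b x + 20 * b * kappa a b 1 x / root_bx b x ^ 3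
          + 40 * b * kappa a b 2 x / root_bx b x ^ 5 + b * root_bx b x * kappa a b 0 x)
       = antiderivatives (\<lambda>x. 5 * gauss_exp a b x / x + 20 * (1 / (b * x) + 1) * gauss_exp a b x / (b * x^2)
          + 40 * (3 / (b^2 * x^2) + 3 / (b * x) + 1) * gauss_exp a b x / (b^2 * x^3)
          + b * gauss_exp a b x)"
    by (rule antiderivatives_cong, simp only: UG K)
      (use assms in \<open>simp add: field_simps eval_nat_numeral\<close>)
  show "antiderivatives (\<lambda>x. 5 * gauss_exp a b x / x + 20 * (1 / (b * x) + 1) * gauss_exp a b x / (b * x^2)
          + 40 * (3 / (b^2 * x^2) + 3 / (b * x) + 1) * gauss_exp a b x / (b^2 * x^3)
          + b * gauss_exp a b x)
       = plus_const (\<lambda>x. 5 * Upsilon 1 a b x + 20 / b * Upsilon 2 a b x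
          + 60 / b^2 * Upsilon 3 a b x + 120 / b^3 * Upsilon 4 a b x
          + 120 / b^4 * Upsilon 5 a b x + b * V00 a b x)"
    by (intro antiderivatives_eq_plus_const, rule has_vector_derivative_eq_rhs,
        (rule has_vector_derivative_add has_vector_derivative_mult_right
          has_vector_derivative_Upsilon_numeral has_vector_derivative_V00 has_vector_derivative_V11
          assms | assumption)+)
      (use assms in \<open>simp_all add: field_simps eval_nat_numeral\<close>)
  show "antiderivatives (\<lambda>x. exp (- a * x^2) * upper_Gamma 7 (b * x) / (b^4 * x^5))
       = antiderivatives (\<lambda>x. 30 * b * kappa a b 0 x / root_bx b x + 120 * b * kappa a b 1 x / root_bx b x ^ 3
          + 240 * b * kappa a b 2 x / root_bx b x ^ 5 + 5 * b * root_bx b x * kappa a b 0 x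
          + b * root_bx b x ^ 3 * kappa a b 1 x)"
    by (rule antiderivatives_cong, simp only: UG K)
      (use assms in \<open>simp add: field_simps eval_nat_numeral\<close>)
  show "antiderivatives (\<lambda>x. 30 * b * kappa a b 0 x / root_bx b x + 120 * b * kappa a b 1 x / root_bx b x ^ 3
          + 240 * b * kappa a b 2 x / root_bx b x ^ 5 + 5 * b * root_bx b x * kappa a b 0 x
          + b * root_bx b x ^ 3 * kappa a b 1 x)
       = antiderivatives (\<lambda>x. 30 * gauss_exp a b x / x + 120 * (1 / (b * x) + 1) * gauss_exp a b x / (b * x^2)
          + 240 * (3 / (b^2 * x^2) + 3 / (b * x) + 1) * gauss_exp a b x / (b^2 * x^3)
          + 5 * b * gauss_exp a b x + b^2 * x * (1 / (b * x) + 1) * gauss_exp a b x)"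
    by (rule antiderivatives_cong, simp only: UG K)
      (use assms in \<open>simp add: field_simps eval_nat_numeral\<close>)
  show "antiderivatives (\<lambda>x. 30 * gauss_exp a b x / x + 120 * (1 / (b * x) + 1) * gauss_exp a b x / (b * x^2)
          + 240 * (3 / (b^2 * x^2) + 3 / (b * x) + 1) * gauss_exp a b x / (b^2 * x^3)
          + 5 * b * gauss_exp a b x + b^2 * x * (1 / (b * x) + 1) * gauss_exp a b x)
       = plus_const (\<lambda>x. 30 * Upsilon 1 a b x + 120 / b * Upsilon 2 a b x
          + 360 / b^2 * Upsilon 3 a b x + 720 / b^3 * Upsilon 4 a b x
          + 720 / b^4 * Upsilon 5 a b x + 5 * b * V00 a b x
          + b * V11 a b x)"
    by (intro antiderivatives_eq_plus_const, rule has_vector_derivative_eq_rhs,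
        (rule has_vector_derivative_add has_vector_derivative_mult_right
          has_vector_derivative_Upsilon_numeral has_vector_derivative_V00 has_vector_derivative_V11
          assms | assumption)+)
      (use assms in \<open>simp_all add: field_simps eval_nat_numeral\<close>)
qed

end
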